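(* Let $n\ge 2$, let $\Omega\subset\mathbb{R}^n$ be a bounded connected open set, and let $F\in C^0(\Omega\times\mathbb{R}\times\mathbb{R}^n\times\mathcal{S}^{n\times n})$ satisfy $$F(x,s,p,M+N)\ge F(x,s,p,M)\quad\text{for all }(x,s,p,M)\in\Omega\times\mathbb{R}\times\mathbb{R}^n\times\mathcal{S}^{n\times n}\text{ and all }N\in\mathcal{S}^{n\times n}_+.$$ Let $E\subset\Omega$ be a smooth closed submanifold of dimension $k$, $0\le k\le n-2$, and let $f\in USC(\Omega)$. Assume that $u\in LSC(\Omega\setminus E)$ satisfies $$\inf_{\Omega\setminus E}u>-\infty$$ and $$\lambda_1(\nabla^2u)+\cdots+\lambda_{k+2}(\nabla^2u)\le 0\quad\text{in }\Omega\setminus E\text{ in the viscosity sense}.$$ Then, after extending $u$ to $E$ by letting $$u(x):=\liminf_{y\in\Omega\setminus E,\ y\to x}u(y),\qquad x\in E,$$ $u$ is in $LSC(\Omega)$ and is lowerconical on $E$.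
   Context: $\mathcal{S}^{n\times n}$ is the set of real symmetric $n\times n$ matrices and $\mathcal{S}^{n\times n}_+$ its subset of positive definite matrices. $\lambda_1(M)\le\lambda_2(M)\le\cdots\le\lambda_n(M)$ denote the eigenvalues of $M\in\mathcal{S}^{n\times n}$ in increasing order. $LSC$ and $USC$ denote sets of lower-/upper-semicontinuous functions. A closed submanifold is compact and without boundary (for $k=0$: finitely many points). The eigenvalue inequality holds in the viscosity sense in $\Omega\setminus E$ if whenever $x_0\in\Omega\setminus E$ and $\varphi$ is $C^2$ near $x_0$ with $\varphi\le u$ near $x_0$ and $\varphi(x_0)=u(x_0)$, one has $\sum_{i=1}^{k+2}\lambda_i(\nabla^2\varphi(x_0))\le0$. Lowerconical on a set: a lower-semicontinuous $u$ on $\Omega$ with $\inf_\Omega u>-\infty$ is lowerconical on $E\subset\Omega$ if for every $\eta\in C^\infty(\Omega)$, every $\bar x\in E$ and every $\epsilon>0$, $$\inf_{x\in\Omega}\Big((u+\eta)(x)-(u+\eta)(\bar x)-\epsilon\,\mathrm{dist}(x,E)\Big)<0.$$ The extended $u$ may take the value $+\infty$ at points of $E$; at a point $\bar x\in E$ with $u(\bar x)=+\infty$ the lowerconical condition is regarded as satisfied (the expression equals $-\infty$ for $x\in\Omega\setminus E$). *)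

theory Defs
  imports "HOL-Analysis.Analysis" "HOL-Computational_Algebra.Polynomial"
begin

section \<open>Symmetric matrices and their ordered eigenvalues\<close>

definition sym_matrices :: "(real ^ 'n ^ 'n) set" where
  "sym_matrices = {M. transpose M = M}"

definition pos_def_matrices :: "(real ^ 'n ^ 'n) set" where
  "pos_def_matrices = {N \<in> sym_matrices. \<forall>v. v \<noteq> 0 \<longrightarrow> v \<bullet> (N *v v) > 0}"

definition charpoly :: "real ^ 'n ^ 'n \<Rightarrow> real poly" where
  "charpoly M = det (\<chi> i j. (if i = j then [:0, 1:] else 0) - [:M $ i $ j:])"

text \<open>
  For a symmetric \<open>n \<times> n\<close> matrix all \<open>n\<close> roots of the characteristic polynomial are real,
  so the list below has length \<open>n\<close>. The index \<open>i\<close> starts at 1, and eigenvalues are repeated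
  according to multiplicity.
\<close>

definition eigval :: "nat \<Rightarrow> real ^ 'n ^ 'n \<Rightarrow> real" where
  "eigval i M = sorted_list_of_multiset (proots (charpoly M)) ! (i - 1)"


section \<open>\<open>C\<^sup>k\<close> and smooth maps on open sets\<close>

text \<open>Meaningful for open sets \<open>S\<close>, since the derivatives are taken in the whole space.\<close>

primrec Ck_on :: "nat \<Rightarrow> ('a::euclidean_space \<Rightarrow> 'b::euclidean_space) \<Rightarrow> 'a set \<Rightarrow> bool" where
  "Ck_on 0 f S \<longleftrightarrow> continuous_on S f"
| "Ck_on (Suc m) f S \<longleftrightarrow>
     (\<forall>x\<in>S. f differentiable (at x)) \<and>
     (\<forall>v. Ck_on m (\<lambda>x. frechet_derivative f (at x) v) S)"

definition Cinf_on :: "('a::euclidean_space \<Rightarrow> 'b::euclidean_space) \<Rightarrow> 'a set \<Rightarrow> bool" where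
  "Cinf_on f S \<longleftrightarrow> (\<forall>m. Ck_on m f S)"

definition partial :: "'n \<Rightarrow> (real ^ 'n \<Rightarrow> real) \<Rightarrow> real ^ 'n \<Rightarrow> real" where
  "partial i f x = frechet_derivative f (at x) (axis i 1)"

definition hessian :: "(real ^ 'n \<Rightarrow> real) \<Rightarrow> real ^ 'n \<Rightarrow> real ^ 'n ^ 'n" where
  "hessian f x = (\<chi> i j. partial i (partial j f) x)"


section \<open>Closed embedded submanifolds\<close>

text \<open>
  Around each of its points the set is, in a smooth chart of the ambient space, a relatively
  open piece of a \<open>k\<close>-dimensional linear subspace; hence there is no boundary. Connectedness is
  not required; for \<open>k = 0\<close> these are exactly the finite sets.
\<close>

definition smooth_closed_submanifold :: "nat \<Rightarrow> 'a::euclidean_space set \<Rightarrow> bool" where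
  "smooth_closed_submanifold k E \<longleftrightarrow>
     compact E \<and>
     (\<forall>x\<in>E. \<exists>U V g h L.
        open U \<and> x \<in> U \<and> open V \<and>
        homeomorphism U V g h \<and> Cinf_on g U \<and> Cinf_on h V \<and>
        subspace L \<and> dim L = k \<and> g ` (U \<inter> E) = V \<inter> (L :: 'a set))"


section \<open>Semicontinuity\<close>

definition lsc_on :: "'a::topological_space set \<Rightarrow> ('a \<Rightarrow> 'b::linorder) \<Rightarrow> bool" where
  "lsc_on S u \<longleftrightarrow> (\<forall>x\<in>S. \<forall>c < u x. eventually (\<lambda>y. c < u y) (at x within S))"

definition usc_on :: "'a::topological_space set \<Rightarrow> ('a \<Rightarrow> 'b::linorder) \<Rightarrow> bool" where
  "usc_on S u \<longleftrightarrow> (\<forall>x\<in>S. \<forall>c > u x. eventually (\<lambda>y. u y < c) (at x within S))"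


section \<open>Viscosity supersolutions and lowerconical functions\<close>

definition visc_eigval_sum_nonpos :: "nat \<Rightarrow> (real ^ 'n) set \<Rightarrow> (real ^ 'n \<Rightarrow> real) \<Rightarrow> bool" where
  "visc_eigval_sum_nonpos m S u \<longleftrightarrow>
     (\<forall>x0\<in>S. \<forall>\<phi> U.
        open U \<and> x0 \<in> U \<and> Ck_on 2 \<phi> U \<and> (\<forall>x\<in>U \<inter> S. \<phi> x \<le> u x) \<and> \<phi> x0 = u x0 \<longrightarrow>
        (\<Sum>i=1..m. eigval i (hessian \<phi> x0)) \<le> 0)"

definition liminf_extension ::
  "(real ^ 'n) set \<Rightarrow> (real ^ 'n) set \<Rightarrow> (real ^ 'n \<Rightarrow> real) \<Rightarrow> real ^ 'n \<Rightarrow> ereal" where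
  "liminf_extension \<Omega> E u x =
     (if x \<in> E then Liminf (at x within (\<Omega> - E)) (\<lambda>y. ereal (u y)) else ereal (u x))"

text \<open>
  The case \<open>u z = \<infinity>\<close> is listed separately because the convention \<open>\<infinity> - \<infinity> = \<infinity>\<close> of
  \<^typ>\<open>ereal\<close> should play no role.
\<close>

definition lowerconical_on ::
  "(real ^ 'n) set \<Rightarrow> (real ^ 'n) set \<Rightarrow> (real ^ 'n \<Rightarrow> ereal) \<Rightarrow> bool" where
  "lowerconical_on \<Omega> E u \<longleftrightarrow>
     lsc_on \<Omega> u \<and> (INF x\<in>\<Omega>. u x) > -\<infinity> \<and>
     (\<forall>\<eta> :: real ^ 'n \<Rightarrow> real. \<forall>z\<in>E. \<forall>\<epsilon>>0. Cinf_on \<eta> \<Omega> \<longrightarrow>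
        u z = \<infinity> \<or>
        (INF x\<in>\<Omega>. (u x + ereal (\<eta> x)) - (u z + ereal (\<eta> z)) - ereal (\<epsilon> * infdist x E)) < 0)"

end

theory Submission
  imports Defs
begin

text \<open>
  Write \<open>d\<close> for the distance to \<open>E\<close> and suppose that the lowerconical condition fails at a
  point \<open>z\<close> of \<open>E\<close>. Then, for some smooth \<open>\<eta>\<close> and some \<open>\<epsilon> > 0\<close>,
  \[ u \ge u(z) + \eta(z) - \eta + \epsilon\, d \qquad \mbox{in } \Omega - E, \]
  a cone-like lower bound with vertex along \<open>E\<close>. The function \<open>\<epsilon> d\<close> is very convex near \<open>E\<close>: of
  the eigenvalues of its Hessian, \<open>k\<close> are bounded (directions tangent to \<open>E\<close>), one vanishes
  (the radial direction), and the others are close to \<open>\<epsilon> / d\<close>. Hence any \<open>k + 2\<close>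
  of them have a sum of at least about \<open>\<epsilon> / d\<close>, which is incompatible with the viscosity inequality
  as soon as a function of this kind touches \<open>u\<close> from below off \<open>E\<close>.

  Two corrections force such a contact. Subtracting \<open>\<bar>x - z\<bar>\<^sup>2\<close> keeps it away from the boundary of
  a small ball around \<open>z\<close>. Adding \<open>\<delta> ln d\<close>, which is \<open>-\<infinity>\<close> on \<open>E\<close>, keeps it away from \<open>E\<close>. The
  logarithm is harmless: in the radial direction its second derivative is
  \<open>-\<delta> / d\<^sup>2\<close>, but the \<open>\<delta> / d\<^sup>2\<close> of at least one further normal direction cancels this, and the
  remainder \<open>O(\<delta> / d)\<close> is absorbed by \<open>\<epsilon> / d\<close>. Because \<open>u(z)\<close> is a limit of values of \<open>u\<close> off \<open>E\<close>,
  the difference of \<open>u\<close> and the resulting function \<open>barrier\<close> is, for small \<open>\<delta>\<close>, smaller at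
  some point near \<open>z\<close> than anywhere near \<open>E\<close> or on the sphere, so its minimum is attained
  at an interior point off \<open>E\<close>. This contradicts \<open>barrier_touches_nowhere\<close>.

  The barrier only has to be bounded from below, to second order, at a contact point.
  At such a point \<open>x0\<close> with nearest point \<open>e0\<close> in \<open>E\<close>, the tangent approximation of \<open>E\<close> at \<open>e0\<close>
  gives an explicit quadratic lower bound for \<open>d\<^sup>2\<close> that is sharp at \<open>x0\<close>
  (\<open>dist_squared_lower_bound\<close>). A one-variable Taylor expansion turns it into a quadratic polynomial
  below the barrier (\<open>barrier_quadratic_lower_bound\<close>), and this polynomial is the test function.

  The sum of the lowest eigenvalues of its Hessian is the trace over some orthonormal family
  (\<open>eigval_sum_eq_orthonormal_trace\<close>). Bessel's inequality bounds the contribution of the tangential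
  and radial directions to this trace (\<open>trace_rank_perturbation\<close>).
\<close>

section \<open>Sums of lowest eigenvalues as traces\<close>

text \<open>
  A maximiser \<open>v\<close> of the quadratic form on the unit sphere of \<open>S\<close> is an eigenvector: the form
  \<open>c (w \<bullet> w) - w \<bullet> f w\<close>, with \<open>c\<close> the maximum, is nonnegative on \<open>S\<close> and vanishes at \<open>v\<close>, so its
  first variation there, in the direction of the residual \<open>c v - f v\<close>, is zero.
\<close>

lemma selfadjoint_eigenvector_exists:
  fixes f :: "'a::euclidean_space \<Rightarrow> 'a"
  assumes lin: "linear f" and sa: "\<And>x y. f x \<bullet> y = x \<bullet> f y"
    and S: "subspace S" "f ` S \<subseteq> S" "S \<noteq> {0}"
  shows "\<exists>v\<in>S. \<exists>c. norm v = 1 \<and> f v = c *\<^sub>R v"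
proof -
  interpret f: linear f by (rule lin)
  let ?K = "S \<inter> sphere 0 1"
  have "compact ?K"
    using closed_subspace[OF S(1)] by (simp add: closed_Int_compact)
  moreover have "?K \<noteq> {}"
  proof -
    obtain w where w: "w \<in> S" "w \<noteq> 0" using S subspace_0 by blast
    have "w /\<^sub>R norm w \<in> ?K" using w S(1) by (simp add: subspace_scale)
    then show ?thesis by blast
  qed
  moreover have "continuous_on ?K (\<lambda>v. v \<bullet> f v)"
    by (intro continuous_intros linear_continuous_on linear_conv_bounded_linear[THEN iffD1] lin)
  ultimately obtain v where v: "v \<in> ?K" and vmax: "\<And>w. w \<in> ?K \<Longrightarrow> w \<bullet> f w \<le> v \<bullet> f v"
    using continuous_attains_sup[of ?K "\<lambda>v. v \<bullet> f v"] by blast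
  define c where "c = v \<bullet> f v"
  have vv: "v \<bullet> v = 1" using v by (simp add: norm_eq_1)
  have quad: "w \<bullet> f w \<le> c * (w \<bullet> w)" if "w \<in> S" for w
  proof (cases "w = 0")
    case False
    have "(w /\<^sub>R norm w) \<bullet> f (w /\<^sub>R norm w) \<le> c"
      unfolding c_def using that False S(1) by (intro vmax) (simp add: subspace_scale)
    then have "(w \<bullet> f w) / (norm w)\<^sup>2 \<le> c"
      by (simp add: f.scale power2_eq_square field_simps)
    then show ?thesis using False by (simp add: field_simps power2_norm_eq_inner)
  qed simp
  define w where "w = c *\<^sub>R v - f v"
  have wS: "w \<in> S" unfolding w_def using v S by (auto intro!: subspace_diff subspace_scale)
  define g where "g = c * (w \<bullet> w) - w \<bullet> f w"
  have g0: "g \<ge> 0" using quad[OF wS] by (simp add: g_def)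
  \<comment> \<open>nonnegativity of the form at \<open>v + t w\<close>\<close>
  have key: "0 \<le> 2 * t * (w \<bullet> w) + t\<^sup>2 * g" for t
  proof -
    have "v + t *\<^sub>R w \<in> S" using v wS S by (auto intro!: subspace_add subspace_scale)
    from quad[OF this]
    have "0 \<le> c * ((v + t *\<^sub>R w) \<bullet> (v + t *\<^sub>R w)) - (v + t *\<^sub>R w) \<bullet> f (v + t *\<^sub>R w)" by simp
    also have "\<dots> = 2 * t * (c * (v \<bullet> w) - w \<bullet> f v) + t\<^sup>2 * g"
      using sa[of v w] vv by (simp add: f.add f.scale inner_simps inner_commute[of w v] g_def c_def power2_eq_square algebra_simps inner_commute[of "f v" w])
    also have "c * (v \<bullet> w) - w \<bullet> f v = w \<bullet> w"
      using inner_diff_right[of w "c *\<^sub>R v" "f v"] unfolding w_def[symmetric] by (simp add: inner_commute)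
    finally show ?thesis .
  qed
  have "w \<bullet> w = 0"
  proof (rule ccontr)
    assume "w \<bullet> w \<noteq> 0"
    then have b: "w \<bullet> w > 0" by simp
    define b where "b = w \<bullet> w"
    \<comment> \<open>the step \<open>t = - b s\<close> makes the linear term win over \<open>t\<^sup>2 g\<close>\<close>
    define s where "s = 1 / (g + 1)"
    have s: "s > 0" "s * g = 1 - s" using g0 by (auto simp: s_def field_simps)
    have "0 \<le> 2 * (- b * s) * b + (- b * s)\<^sup>2 * g" unfolding b_def by (rule key)
    also have "\<dots> = b\<^sup>2 * s * (s * g - 2)" by (simp add: power2_eq_square algebra_simps)
    also have "\<dots> < 0" unfolding s(2) using b s(1) unfolding b_def by (intro mult_pos_neg) auto
    finally show False by simp
  qed
  then have "f v = c *\<^sub>R v" by (simp add: w_def)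
  then show ?thesis using v by auto
qed

lemma selfadjoint_orthonormal_eigenbasis:
  fixes f :: "'a::euclidean_space \<Rightarrow> 'a"
  assumes lin: "linear f" and sa: "\<And>x y. f x \<bullet> y = x \<bullet> f y"
    and "subspace S" "f ` S \<subseteq> S"
  shows "\<exists>B. B \<subseteq> S \<and> finite B \<and> card B = dim S \<and> pairwise orthogonal B \<and>
             (\<forall>b\<in>B. norm b = 1 \<and> (\<exists>c. f b = c *\<^sub>R b))"
  using assms(3,4)
proof (induction "dim S" arbitrary: S)
  case 0
  then show ?case by (intro exI[of _ "{}"]) auto
next
  case (Suc d)
  have "S \<noteq> {0}" using Suc.hyps(2) by auto
  then obtain v c where v: "v \<in> S" "norm v = 1" "f v = c *\<^sub>R v"
    using selfadjoint_eigenvector_exists[OF lin sa Suc.prems] by auto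
  define S' where "S' = {y \<in> S. \<forall>x\<in>span {v}. orthogonal x y}"
  have S'_eq: "S' = {y \<in> S. orthogonal v y}"
    unfolding S'_def by (auto simp: span_singleton orthogonal_def intro: exI[of _ 1])
  have "dim S' + dim (span {v}) = dim S"
    unfolding S'_def using v(1) Suc.prems(1)
    by (intro dim_subspace_orthogonal_to_vectors) (auto simp: span_minimal)
  moreover have "dim (span {v}) = 1" using v(2) by auto
  ultimately have dimS': "dim S' = d" using Suc.hyps(2) by simp
  have subS': "subspace S'"
    using Suc.prems(1) unfolding S'_eq subspace_def by (auto simp: orthogonal_def inner_simps)
  have "f ` S' \<subseteq> S'"
    using Suc.prems(2) v(3) unfolding S'_eq by (auto simp: orthogonal_def sa[symmetric])
  from Suc.hyps(1)[OF dimS'[symmetric] subS' this] obtain B where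
    B: "B \<subseteq> S'" "finite B" "card B = dim S'" "pairwise orthogonal B"
       "\<forall>b\<in>B. norm b = 1 \<and> (\<exists>c. f b = c *\<^sub>R b)" by blast
  have "v \<notin> B" using B(1) v(2) by (auto simp: S'_eq orthogonal_def)
  show ?case
  proof (intro exI[of _ "insert v B"] conjI)
    show "insert v B \<subseteq> S" using B(1) v(1) by (auto simp: S'_eq)
    show "card (insert v B) = dim S" using B \<open>v \<notin> B\<close> dimS' Suc.hyps(2) by simp
    show "pairwise orthogonal (insert v B)"
      using B(1,4) by (auto simp: S'_eq pairwise_insert orthogonal_commute)
    show "\<forall>b\<in>insert v B. norm b = 1 \<and> (\<exists>c. f b = c *\<^sub>R b)" using B(5) v by auto
  qed (use B in auto)
qed

lemma symmetric_matrix_eigenbasis: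
  fixes M :: "real ^ 'n ^ 'n"
  assumes "transpose M = M"
  obtains e :: "'n \<Rightarrow> real ^ 'n" and ev :: "'n \<Rightarrow> real"
  where "\<And>i j. e i \<bullet> e j = (if i = j then 1 else 0)" "\<And>i. M *v e i = ev i *\<^sub>R e i"
proof -
  have sa: "(M *v x) \<bullet> y = x \<bullet> (M *v y)" for x y
    by (metis assms dot_lmul_matrix transpose_matrix_vector inner_commute)
  obtain B where B: "finite B" "card B = CARD('n)" "pairwise orthogonal B"
      "\<forall>b\<in>B. norm b = 1 \<and> (\<exists>c. M *v b = c *\<^sub>R b)"
    using selfadjoint_orthonormal_eigenbasis[of "(*v) M" UNIV] sa by auto
  obtain e :: "'n \<Rightarrow> _" where e: "bij_betw e UNIV B"
    using finite_same_card_bij[of "UNIV :: 'n set" B] B by auto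
  have eB: "e i \<in> B" for i using e by (auto simp: bij_betw_def)
  have ne: "e i \<noteq> e j" if "i \<noteq> j" for i j using e that by (auto simp: bij_betw_def inj_def)
  have "\<exists>c. M *v e i = c *\<^sub>R e i" for i using B(4) eB by blast
  then obtain ev where "\<And>i. M *v e i = ev i *\<^sub>R e i" by metis
  moreover have "e i \<bullet> e j = (if i = j then 1 else 0)" for i j
    using B(3,4) eB ne[of i j] by (auto simp: norm_eq_1 pairwise_def orthogonal_def)
  ultimately show ?thesis by (intro that[of e ev])
qed

text \<open>
  With the matrix \<open>Q\<close> of eigenvectors, \<open>(X I - M) Q = Q D\<close> for the diagonal matrix \<open>D\<close> of the linear
  factors. This holds over the polynomial ring, where \<open>det Q\<close> is a unit because \<open>Q\<close> has the
  transpose \<open>R\<close> as its inverse.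
\<close>

lemma charpoly_eq_prod:
  fixes M :: "real ^ 'n ^ 'n" and e :: "'n \<Rightarrow> real ^ 'n"
  assumes orth: "\<And>i j. e i \<bullet> e j = (if i = j then 1 else 0)"
    and eig: "\<And>i. M *v e i = ev i *\<^sub>R e i"
  shows "charpoly M = (\<Prod>i\<in>UNIV. [:- ev i, 1:])"
proof -
  define Q :: "real poly ^ 'n ^ 'n" where "Q = (\<chi> i j. [:e j $ i:])"
  define R :: "real poly ^ 'n ^ 'n" where "R = (\<chi> i j. [:e i $ j:])"
  define D :: "real poly ^ 'n ^ 'n" where "D = (\<chi> i j. if i = j then [:- ev i, 1:] else 0)"
  define C :: "real poly ^ 'n ^ 'n"
    where "C = (\<chi> i j. (if i = j then [:0, 1:] else 0) - [:M $ i $ j:])"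
  have hom: "(\<Sum>i\<in>A. [:h i:]) = [:\<Sum>i\<in>A. h i:]" for A and h :: "'n \<Rightarrow> real"
    by (induction A rule: infinite_finite_induct) auto
  have "R ** Q = mat 1"
    using orth by (auto simp: vec_eq_iff R_def Q_def matrix_matrix_mult_def mat_def hom inner_vec_def
        mult.commute one_pCons)
  then have dRQ: "det R * det Q = 1" by (metis det_mul det_I)
  have eig': "(\<Sum>k\<in>UNIV. M $ i $ k * e j $ k) = ev j * e j $ i" for i j
    using eig[of j] by (simp add: vec_eq_iff matrix_vector_mult_def)
  have "C ** Q = Q ** D"
  proof -
    have "(C ** Q) $ i $ j = (Q ** D) $ i $ j" for i j
    proof -
      have "(C ** Q) $ i $ j = (\<Sum>k\<in>UNIV. (if i = k then [:0, 1:] * [:e j $ k:] else 0)) - (\<Sum>k\<in>UNIV. [:M $ i $ k * e j $ k:])"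
        unfolding C_def Q_def matrix_matrix_mult_def sum_subtractf[symmetric]
        by (simp add: left_diff_distrib) (rule sum.cong, auto simp: mult.commute)
      also have "\<dots> = [:- (ev j * e j $ i), e j $ i:]"
        unfolding hom eig' by simp
      also have "\<dots> = (\<Sum>k\<in>UNIV. (if k = j then [:e k $ i:] * [:- ev k, 1:] else 0))"
        by (simp add: mult.commute)
      also have "\<dots> = (Q ** D) $ i $ j"
        unfolding D_def Q_def matrix_matrix_mult_def vec_lambda_beta
        by (rule sum.cong) auto
      finally show ?thesis .
    qed
    then show ?thesis by (simp add: vec_eq_iff)
  qed
  then have CD: "det C * det Q = det Q * det D" by (metis det_mul)
  have "det C = det C * (det R * det Q)" by (simp add: dRQ)
  also have "\<dots> = (det C * det Q) * det R" by (simp only: ac_simps)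
  also have "\<dots> = det D * (det R * det Q)" by (simp only: CD ac_simps)
  also have "\<dots> = det D" by (simp add: dRQ)
  also have "det D = (\<Prod>i\<in>UNIV. D $ i $ i)" by (rule det_diagonal) (simp add: D_def)
  finally show ?thesis by (simp add: charpoly_def C_def D_def)
qed

text \<open>
  The eigenvalues counted by index are those of an eigenbasis in sorted order, so the
  first \<open>m\<close> of them belong to \<open>m\<close> distinct basis vectors.
\<close>

lemma eigval_sum_eq_orthonormal_trace:
  fixes M :: "real ^ 'n ^ 'n"
  assumes "transpose M = M" and m: "m \<le> CARD('n)"
  obtains W :: "(real ^ 'n) set"
  where "finite W" "card W = m" "\<And>v. v \<in> W \<Longrightarrow> norm v = 1" "pairwise orthogonal W"
    "(\<Sum>i=1..m. eigval i M) = (\<Sum>v\<in>W. v \<bullet> (M *v v))"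
proof -
  obtain e :: "'n \<Rightarrow> real ^ 'n" and ev :: "'n \<Rightarrow> real" where
    orth: "\<And>i j. e i \<bullet> e j = (if i = j then 1 else 0)" and eig: "\<And>i. M *v e i = ev i *\<^sub>R e i"
    using symmetric_matrix_eigenbasis[OF assms(1)] by metis
  have "proots (charpoly M) = (\<Sum>i\<in>UNIV. {#ev i#})"
    unfolding charpoly_eq_prod[OF orth eig] by (subst proots_prod) auto
  also have "\<dots> = image_mset ev (mset_set UNIV)"
    by (simp add: sum_unfold_sum_mset)
  finally have roots: "proots (charpoly M) = image_mset ev (mset_set UNIV)" .
  obtain ys :: "'n list" where ys: "set ys = UNIV" "distinct ys"
    using finite_distinct_list[of "UNIV :: 'n set"] by auto
  define xs where "xs = sort_key ev ys"
  have xs: "set xs = UNIV" "distinct xs" unfolding xs_def using ys by auto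
  have "mset xs = mset_set UNIV" using xs by (metis mset_set_set)
  \<comment> \<open>sorting the indices rather than the values keeps track of the eigenvectors\<close>
  have sorted: "sorted_list_of_multiset (proots (charpoly M)) = map ev xs"
  proof -
    have "sort (map ev xs) = map ev xs"
      unfolding xs_def by (intro sorted_sort_id) simp
    then show ?thesis
      by (metis roots \<open>mset xs = mset_set UNIV\<close> mset_map sorted_list_of_multiset_mset)
  qed
  have len: "length xs = CARD('n)" using xs by (metis distinct_card)
  define I where "I = set (take m xs)"
  have inj: "inj e"
    by (rule injI) (metis orth zero_neq_one)
  have "(\<Sum>i=1..m. eigval i M) = (\<Sum>i<m. ev (xs ! i))"
    unfolding eigval_def sorted using len m
    by (simp add: sum.atLeast1_atMost_eq)
  also have "\<dots> = (\<Sum>i\<in>I. ev i)"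
  proof -
    have "I = (!) xs ` {..<m}" unfolding I_def using len m
      by (metis lessThan_atLeast0 nth_image)
    moreover have "inj_on ((!) xs) {..<m}"
      using xs(2) len m by (auto simp: inj_on_def nth_eq_iff_index_eq)
    ultimately show ?thesis by (simp add: sum.reindex)
  qed
  also have "\<dots> = (\<Sum>v\<in>e ` I. v \<bullet> (M *v v))"
    using inj by (simp add: sum.reindex inj_on_def inj_def eig orth)
  finally have "(\<Sum>i=1..m. eigval i M) = (\<Sum>v\<in>e ` I. v \<bullet> (M *v v))" .
  moreover have "card (e ` I) = m"
    using inj xs len m by (simp add: card_image inj_on_def inj_def I_def distinct_card)
  ultimately show ?thesis
    by (intro that[of "e ` I"]) (auto simp: I_def norm_eq_1 orth pairwise_def orthogonal_def)
qed

lemma Bessel_finite: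
  fixes W :: "'a::real_inner set"
  assumes "finite W" "\<And>v. v \<in> W \<Longrightarrow> norm v = 1" "pairwise orthogonal W"
  shows "(\<Sum>v\<in>W. (x \<bullet> v)\<^sup>2) \<le> (norm x)\<^sup>2"
proof -
  let ?p = "\<Sum>v\<in>W. (x \<bullet> v) *\<^sub>R v"
  have vw: "v \<bullet> w = (if v = w then 1 else 0)" if "v \<in> W" "w \<in> W" for v w
    using assms that by (auto simp: norm_eq_1 pairwise_def orthogonal_def)
  have xp: "x \<bullet> ?p = (\<Sum>v\<in>W. (x \<bullet> v)\<^sup>2)"
    by (simp add: inner_sum_right power2_eq_square)
  have "v \<bullet> ?p = x \<bullet> v" if "v \<in> W" for v
  proof -
    have "v \<bullet> ?p = (\<Sum>w\<in>W. if w = v then x \<bullet> w else 0)"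
      unfolding inner_sum_right by (rule sum.cong) (auto simp: vw that)
    then show ?thesis using that assms(1) by simp
  qed
  then have pp: "?p \<bullet> ?p = (\<Sum>v\<in>W. (x \<bullet> v)\<^sup>2)"
    by (subst inner_sum_left) (simp add: power2_eq_square)
  have "0 \<le> (x - ?p) \<bullet> (x - ?p)" by simp
  also have "\<dots> = x \<bullet> x - 2 * (x \<bullet> ?p) + ?p \<bullet> ?p" by (simp add: inner_diff inner_commute)
  finally show ?thesis using xp pp by (simp add: power2_norm_eq_inner)
qed

text \<open>
  By Bessel's inequality, each rank-one form with a unit vector \<open>b\<close> reduces the trace by \<open>\<beta>\<close>
  at most, however large the orthonormal family \<open>W\<close> is.
\<close>

lemma trace_rank_perturbation:
  fixes W B :: "'a::real_inner set" and y :: 'a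
  assumes W: "finite W" "\<And>v. v \<in> W \<Longrightarrow> norm v = 1" "pairwise orthogonal W"
    and B: "finite B" "\<And>b. b \<in> B \<Longrightarrow> norm b = 1"
    and "\<beta> \<ge> 0" "\<gamma> \<ge> 0"
  shows "(\<Sum>v\<in>W. v \<bullet> (\<alpha> *\<^sub>R v - \<beta> *\<^sub>R (\<Sum>b\<in>B. (b \<bullet> v) *\<^sub>R b) - (\<gamma> * (y \<bullet> v)) *\<^sub>R y))
    \<ge> \<alpha> * card W - \<beta> * card B - \<gamma> * (norm y)\<^sup>2"
proof -
  note Bessel = Bessel_finite[OF W]
  have "(\<Sum>v\<in>W. v \<bullet> (\<alpha> *\<^sub>R v - \<beta> *\<^sub>R (\<Sum>b\<in>B. (b \<bullet> v) *\<^sub>R b) - (\<gamma> * (y \<bullet> v)) *\<^sub>R y))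
     = (\<Sum>v\<in>W. \<alpha> - \<beta> * (\<Sum>b\<in>B. (b \<bullet> v)\<^sup>2) - \<gamma> * (y \<bullet> v)\<^sup>2)"
    using W(2) by (intro sum.cong)
      (simp_all add: inner_diff_right inner_sum_right norm_eq_1 power2_eq_square inner_commute)
  also have "\<dots> = \<alpha> * card W - \<beta> * (\<Sum>b\<in>B. \<Sum>v\<in>W. (b \<bullet> v)\<^sup>2) - \<gamma> * (\<Sum>v\<in>W. (y \<bullet> v)\<^sup>2)"
    by (subst sum.swap) (simp add: sum_subtractf sum_distrib_left mult.commute)
  finally have eq: "(\<Sum>v\<in>W. v \<bullet> (\<alpha> *\<^sub>R v - \<beta> *\<^sub>R (\<Sum>b\<in>B. (b \<bullet> v) *\<^sub>R b) - (\<gamma> * (y \<bullet> v)) *\<^sub>R y)) = \<dots>" .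
  have "(\<Sum>b\<in>B. \<Sum>v\<in>W. (b \<bullet> v)\<^sup>2) \<le> (\<Sum>b\<in>B. 1)"
    by (rule sum_mono) (metis Bessel B(2) one_power2)
  then have "\<beta> * (\<Sum>b\<in>B. \<Sum>v\<in>W. (b \<bullet> v)\<^sup>2) \<le> \<beta> * card B"
    using \<open>\<beta> \<ge> 0\<close> by (intro mult_left_mono) auto
  moreover have "\<gamma> * (\<Sum>v\<in>W. (y \<bullet> v)\<^sup>2) \<le> \<gamma> * (norm y)\<^sup>2"
    using \<open>\<gamma> \<ge> 0\<close> Bessel by (intro mult_left_mono) auto
  ultimately show ?thesis unfolding eq by linarith
qed

section \<open>Quadratic polynomials as test functions\<close>

lemma has_derivative_quadratic:
  fixes f :: "'a::euclidean_space \<Rightarrow> 'a"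
  assumes lin: "linear f" and sa: "\<And>x y. f x \<bullet> y = x \<bullet> f y"
  shows "((\<lambda>x. c + b \<bullet> (x - x0) + (x - x0) \<bullet> f (x - x0)) has_derivative
           (\<lambda>v. b \<bullet> v + 2 * (v \<bullet> f (x - x0)))) (at x)"
proof -
  have bl: "bounded_linear f" using lin by (simp add: linear_conv_bounded_linear)
  have f': "((\<lambda>x. f (x - x0)) has_derivative f) (at x)"
    by (rule bounded_linear.has_derivative[OF bl, of _ "\<lambda>v. v"]) (auto intro!: derivative_eq_intros)
  show ?thesis
    using sa[of "x - x0"] by (auto intro!: derivative_eq_intros f' simp: inner_commute)
qed

lemma quadratic_Ck2_hessian:
  fixes f :: "real ^ 'n \<Rightarrow> real ^ 'n" and b x0 x :: "real ^ 'n" and c :: real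
  assumes lin: "linear f" and sa: "\<And>x y. f x \<bullet> y = x \<bullet> f y"
  defines "\<phi> \<equiv> \<lambda>x. c + b \<bullet> (x - x0) + (x - x0) \<bullet> f (x - x0)"
  shows "Ck_on 2 \<phi> S" and "hessian \<phi> x = matrix (\<lambda>v. 2 *\<^sub>R f v)"
proof -
  have bl: "bounded_linear f" using lin by (simp add: linear_conv_bounded_linear)
  have d1: "(\<phi> has_derivative (\<lambda>v. b \<bullet> v + 2 * (v \<bullet> f (x - x0)))) (at x)" for x
    unfolding \<phi>_def by (rule has_derivative_quadratic[OF lin sa])
  have fd1: "frechet_derivative \<phi> (at x) = (\<lambda>v. b \<bullet> v + 2 * (v \<bullet> f (x - x0)))" for x
    using d1 by (metis frechet_derivative_at)
  have d2: "((\<lambda>x. b \<bullet> v + 2 * (v \<bullet> f (x - x0))) has_derivative (\<lambda>w. 2 * (v \<bullet> f w))) (at x)" for v x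
  proof -
    have f': "((\<lambda>x. f (x - x0)) has_derivative f) (at x)"
      by (rule bounded_linear.has_derivative[OF bl, of _ "\<lambda>v. v"]) (auto intro!: derivative_eq_intros)
    show ?thesis by (auto intro!: derivative_eq_intros f')
  qed
  have fd2: "frechet_derivative (\<lambda>x. b \<bullet> v + 2 * (v \<bullet> f (x - x0))) (at x) = (\<lambda>w. 2 * (v \<bullet> f w))" for v x
    using d2 by (metis frechet_derivative_at)
  show "Ck_on 2 \<phi> S"
    using d1 d2 by (auto simp: numeral_2_eq_2 fd1 fd2 differentiable_def)
  have "partial i (partial j \<phi>) x = 2 * f (axis j 1) $ i" for i j
  proof -
    have "partial j \<phi> = (\<lambda>x. b \<bullet> axis j 1 + 2 * (axis j 1 \<bullet> f (x - x0)))"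
      by (auto simp: partial_def fd1)
    then have "partial i (partial j \<phi>) x = 2 * (axis j 1 \<bullet> f (axis i 1))"
      by (simp add: partial_def fd2)
    also have "axis j 1 \<bullet> f (axis i 1) = f (axis j 1) $ i"
      by (simp add: sa[symmetric] inner_axis)
    finally show ?thesis .
  qed
  then show "hessian \<phi> x = matrix (\<lambda>v. 2 *\<^sub>R f v)"
    by (simp add: hessian_def matrix_def)
qed

section \<open>First-order expansion of maps with continuous second derivatives\<close>

lemma linear_norm_le_sum_Basis:
  fixes A :: "'a::euclidean_space \<Rightarrow> 'b::real_normed_vector"
  assumes "linear A" and "\<And>i. i \<in> Basis \<Longrightarrow> norm (A i) \<le> c i"
  shows "norm (A w) \<le> (\<Sum>i\<in>Basis. c i) * norm w"
proof -
  have "A w = A (\<Sum>i\<in>Basis. (w \<bullet> i) *\<^sub>R i)" by (simp only: euclidean_representation)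
  also have "\<dots> = (\<Sum>i\<in>Basis. (w \<bullet> i) *\<^sub>R A i)"
    by (simp only: linear_sum[OF assms(1)] linear_scale[OF assms(1)])
  finally have "norm (A w) = norm (\<Sum>i\<in>Basis. (w \<bullet> i) *\<^sub>R A i)" by simp
  also have "\<dots> \<le> (\<Sum>i\<in>Basis. c i * norm w)"
  proof (rule sum_norm_le)
    fix i :: 'a assume i: "i \<in> Basis"
    have "\<bar>w \<bullet> i\<bar> * norm (A i) \<le> norm w * c i"
      using i assms(2) by (intro mult_mono) (auto simp: Basis_le_norm)
    then show "norm ((w \<bullet> i) *\<^sub>R A i) \<le> c i * norm w" by (simp add: mult.commute)
  qed
  finally show ?thesis by (simp add: sum_distrib_right)
qed

lemma C1_locally_Lipschitz:
  fixes f :: "'a::euclidean_space \<Rightarrow> 'b::euclidean_space"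
  assumes f: "Ck_on (Suc 0) f S" and S: "open S" "a \<in> S"
  shows "\<exists>r>0. \<exists>C\<ge>0. ball a r \<subseteq> S \<and> (\<forall>x\<in>ball a r. \<forall>y\<in>ball a r. norm (f x - f y) \<le> C * norm (x - y))"
proof -
  obtain r where r: "r > 0" "cball a r \<subseteq> S" using S open_contains_cball by blast
  have "\<exists>c. \<forall>x\<in>cball a r. norm (frechet_derivative f (at x) v) \<le> c" for v
  proof -
    have "continuous_on (cball a r) (\<lambda>x. frechet_derivative f (at x) v)"
      using f r(2) by (auto intro: continuous_on_subset)
    then have "compact ((\<lambda>x. frechet_derivative f (at x) v) ` cball a r)"
      by (simp add: compact_continuous_image)
    then show ?thesis by (auto dest!: compact_imp_bounded simp: bounded_iff)
  qed
  then obtain c where c: "\<And>v x. x \<in> cball a r \<Longrightarrow> norm (frechet_derivative f (at x) v) \<le> c v" by metis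
  define C where "C = (\<Sum>i\<in>Basis. c i)"
  have c0: "c v \<ge> 0" for v
    using order_trans[OF norm_ge_zero c[of a v]] r by simp
  have D: "(f has_derivative frechet_derivative f (at x)) (at x)" if "x \<in> S" for x
    using f that by (auto simp: frechet_derivative_works)
  show ?thesis
  proof (rule exI[of _ r], rule conjI[rotated], rule exI[of _ C], intro conjI ballI)
    show "ball a r \<subseteq> S" using r(2) by (meson ball_subset_cball order_trans)
    show "r > 0" by (rule r(1))
    show "C \<ge> 0" unfolding C_def by (rule sum_nonneg) (rule c0)
    fix x y assume xy: "x \<in> ball a r" "y \<in> ball a r"
    show "norm (f x - f y) \<le> C * norm (x - y)"
    proof (rule differentiable_bound[OF convex_ball _ _ xy])
      fix x assume x: "x \<in> ball a r"
      then have "x \<in> S" using r by auto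
      from D[OF this] show "(f has_derivative frechet_derivative f (at x)) (at x within ball a r)"
        by (rule has_derivative_at_withinI)
      have "norm (frechet_derivative f (at x) w) \<le> C * norm w" for w
        unfolding C_def
      proof (rule linear_norm_le_sum_Basis)
        show "linear (frechet_derivative f (at x))"
          using D[OF \<open>x \<in> S\<close>] by (rule has_derivative_linear)
        show "norm (frechet_derivative f (at x) i) \<le> c i" for i
          using x by (intro c) auto
      qed
      then show "onorm (frechet_derivative f (at x)) \<le> C" by (rule onorm_le)
    qed
  qed
qed

text \<open>
  The quadratic remainder is uniform in both points because all partial derivatives of the first
  derivative are bounded on a common ball, which makes the derivative Lipschitz in operator norm.
\<close>

lemma C2_first_order_Taylor:
  fixes f :: "'a::euclidean_space \<Rightarrow> 'b::euclidean_space"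
  assumes f: "Ck_on 2 f S" and S: "open S" "a \<in> S"
  shows "\<exists>r>0. \<exists>C\<ge>0. ball a r \<subseteq> S \<and>
    (\<forall>x\<in>ball a r. \<forall>y\<in>ball a r.
       norm (f y - f x - frechet_derivative f (at x) (y - x)) \<le> C * (norm (y - x))\<^sup>2)"
proof -
  let ?D = "\<lambda>x. frechet_derivative f (at x)"
  have "\<forall>i. \<exists>r>0. \<exists>C\<ge>0. ball a r \<subseteq> S \<and>
     (\<forall>x\<in>ball a r. \<forall>y\<in>ball a r. norm (?D x i - ?D y i) \<le> C * norm (x - y))"
    using C1_locally_Lipschitz[OF _ S] f unfolding numeral_2_eq_2 Ck_on.simps(2)[of "Suc 0"] by blast
  then obtain r C where r: "\<And>i. r i > 0" "\<And>i. ball a (r i) \<subseteq> S"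
    and C: "\<And>i x y. x \<in> ball a (r i) \<Longrightarrow> y \<in> ball a (r i) \<Longrightarrow> norm (?D x i - ?D y i) \<le> C i * norm (x - y)"
    and C0: "\<And>i. C i \<ge> 0"
    by metis
  define R where "R = Min (r ` Basis)"
  have R: "R > 0" "\<And>i. i \<in> Basis \<Longrightarrow> R \<le> r i" unfolding R_def using r(1) by auto
  have RS: "ball a R \<subseteq> S" using subset_ball[OF R(2)[OF SOME_Basis]] r(2) by (rule order_trans)
  define K where "K = (\<Sum>i\<in>Basis. C i)"
  have "K \<ge> 0" unfolding K_def by (rule sum_nonneg) (rule C0)
  have D: "(f has_derivative ?D x) (at x)" if "x \<in> ball a R" for x
    using f that RS by (auto simp: frechet_derivative_works numeral_2_eq_2)
  have "norm (f y - f x - ?D x (y - x)) \<le> K * (norm (y - x))\<^sup>2"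
    if xy: "x \<in> ball a R" "y \<in> ball a R" for x y
  proof -
    have seg: "closed_segment x y \<subseteq> ball a R" using xy by (simp add: closed_segment_subset)
    have "norm (f y - f x - ?D x (y - x)) \<le> norm (y - x) * (K * norm (y - x))"
    proof (rule differentiable_bound_linearization[where S = "closed_segment x y" and f' = ?D and ?x0.0 = x])
      show "x + t *\<^sub>R (y - x) \<in> closed_segment x y" if "t \<in> {0..1}" for t
        using that unfolding in_segment by (intro exI[of _ t]) (simp add: algebra_simps)
      fix p assume p: "p \<in> closed_segment x y"
      then have pR: "p \<in> ball a R" using seg by blast
      show "(f has_derivative ?D p) (at p within closed_segment x y)"
        using D[OF pR] by (rule has_derivative_at_withinI)
      have lin: "linear (\<lambda>w. ?D p w - ?D x w)"
        using D[OF pR] D[OF xy(1)] by (intro linear_compose_sub has_derivative_linear)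
      have "norm (?D p w - ?D x w) \<le> (\<Sum>i\<in>Basis. C i * norm (p - x)) * norm w" for w
      proof (rule linear_norm_le_sum_Basis[OF lin])
        fix i :: 'a assume "i \<in> Basis"
        then have "ball a R \<subseteq> ball a (r i)" by (intro subset_ball R(2))
        then show "norm (?D p i - ?D x i) \<le> C i * norm (p - x)"
          using pR xy(1) by (intro C) auto
      qed
      then have "onorm (?D p - ?D x) \<le> K * norm (p - x)"
        by (intro onorm_le) (simp add: K_def sum_distrib_right)
      also have "\<dots> \<le> K * norm (y - x)"
        using segment_bound[OF p] \<open>K \<ge> 0\<close> by (intro mult_left_mono) (auto simp: norm_minus_commute)
      finally show "onorm (?D p - ?D x) \<le> K * norm (y - x)" .
    qed auto
    then show ?thesis by (simp add: power2_eq_square mult_ac)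
  qed
  then have "\<exists>C\<ge>0. ball a R \<subseteq> S \<and> (\<forall>x\<in>ball a R. \<forall>y\<in>ball a R.
      norm (f y - f x - ?D x (y - x)) \<le> C * (norm (y - x))\<^sup>2)"
    using RS \<open>K \<ge> 0\<close> by (intro exI[of _ K]) simp
  then show ?thesis using R(1) by (intro exI[of _ R]) simp
qed

section \<open>Second-order lower bounds for a function of one variable\<close>

lemma Taylor2_lower_bound:
  fixes F F1 F2 :: "real \<Rightarrow> real"
  assumes "\<rho> > 0"
    and d1: "\<And>s. \<bar>s - s0\<bar> < \<rho> \<Longrightarrow> DERIV F s :> F1 s"
    and d2: "\<And>s. \<bar>s - s0\<bar> < \<rho> \<Longrightarrow> DERIV F1 s :> F2 s"
    and cont: "isCont F2 s0" and "\<tau> > 0"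
  shows "\<exists>\<sigma>>0. \<forall>y. \<bar>y\<bar> < \<sigma> \<longrightarrow> F (s0 + y) \<ge> F s0 + F1 s0 * y + (F2 s0 / 2 - \<tau>) * y\<^sup>2"
proof -
  obtain \<sigma>1 where \<sigma>1: "\<sigma>1 > 0" "\<And>s. \<bar>s - s0\<bar> < \<sigma>1 \<Longrightarrow> \<bar>F2 s - F2 s0\<bar> < 2 * \<tau>"
    using cont \<open>\<tau> > 0\<close> unfolding continuous_at_eps_delta dist_real_def
    by (meson mult_pos_pos zero_less_numeral)
  define \<sigma> where "\<sigma> = min \<sigma>1 \<rho>"
  have "F (s0 + y) \<ge> F s0 + F1 s0 * y + (F2 s0 / 2 - \<tau>) * y\<^sup>2" if y: "\<bar>y\<bar> < \<sigma>" for y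
  proof (cases "y = 0")
    case False
    define D where "D m = (if m = 0 then F else if m = 1 then F1 else F2)" for m :: nat
    have "\<exists>t. (if s0 + y < s0 then s0 + y < t \<and> t < s0 else s0 < t \<and> t < s0 + y) \<and>
        F (s0 + y) = (\<Sum>m<2. D m s0 / fact m * (s0 + y - s0) ^ m) + D 2 t / fact 2 * (s0 + y - s0) ^ 2"
    proof (rule Taylor[where a = "s0 - \<bar>y\<bar>" and b = "s0 + \<bar>y\<bar>"])
      show "\<forall>m t. m < 2 \<and> s0 - \<bar>y\<bar> \<le> t \<and> t \<le> s0 + \<bar>y\<bar> \<longrightarrow> DERIV (D m) t :> D (Suc m) t"
      proof (intro allI impI)
        fix m :: nat and t :: real assume a: "m < 2 \<and> s0 - \<bar>y\<bar> \<le> t \<and> t \<le> s0 + \<bar>y\<bar>"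
        then have t: "\<bar>t - s0\<bar> < \<rho>" using y by (auto simp: \<sigma>_def)
        have "m = 0 \<or> m = 1" using a by auto
        then show "DERIV (D m) t :> D (Suc m) t"
          using d1[OF t] d2[OF t] by (auto simp: D_def[abs_def])
      qed
    qed (use False in \<open>auto simp: D_def\<close>)
    then obtain t where t: "if s0 + y < s0 then s0 + y < t \<and> t < s0 else s0 < t \<and> t < s0 + y"
      "F (s0 + y) = F s0 + F1 s0 * y + F2 t / 2 * y\<^sup>2"
      by (auto simp: D_def numeral_2_eq_2)
    have "\<bar>t - s0\<bar> < \<sigma>1" using t(1) y by (auto simp: \<sigma>_def split: if_splits)
    from \<sigma>1(2)[OF this] have "F2 s0 / 2 - \<tau> \<le> F2 t / 2" by (simp add: abs_less_iff)
    then have "(F2 s0 / 2 - \<tau>) * y\<^sup>2 \<le> F2 t / 2 * y\<^sup>2" by (rule mult_right_mono) simp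
    then show ?thesis using t(2) by simp
  qed simp
  moreover have "\<sigma> > 0" using \<sigma>1 assms(1) by (simp add: \<sigma>_def)
  ultimately show ?thesis by blast
qed

text \<open>
  Substituting \<open>y = l w + q w\<close> with \<open>l\<close> of first and \<open>q\<close> of second order in \<open>w\<close>: in the quadratic
  Taylor term only \<open>(l w)\<^sup>2\<close> survives, and all that is of higher order in \<open>w\<close> is absorbed by
  \<open>\<tau> \<bar>w\<bar>\<^sup>2\<close>.
\<close>

lemma Taylor2_lower_bound_composed:
  fixes F F1 F2 :: "real \<Rightarrow> real" and l q :: "'a::real_normed_vector \<Rightarrow> real"
  assumes "\<rho> > 0"
    and d1: "\<And>s. \<bar>s - s0\<bar> < \<rho> \<Longrightarrow> DERIV F s :> F1 s"
    and d2: "\<And>s. \<bar>s - s0\<bar> < \<rho> \<Longrightarrow> DERIV F1 s :> F2 s"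
    and cont: "isCont F2 s0" and "\<tau> > 0"
    and l: "\<And>w. \<bar>l w\<bar> \<le> A * norm w" and q: "\<And>w. \<bar>q w\<bar> \<le> C * (norm w)\<^sup>2" and AC: "A \<ge> 0" "C \<ge> 0"
  shows "\<exists>\<sigma>>0. \<forall>w. norm w < \<sigma> \<longrightarrow> \<bar>l w + q w\<bar> < \<rho> \<and>
     F (s0 + (l w + q w)) \<ge> F s0 + F1 s0 * (l w + q w) + F2 s0 / 2 * (l w)\<^sup>2 - \<tau> * (norm w)\<^sup>2"
proof -
  define \<tau>1 where "\<tau>1 = \<tau> / (2 * ((A + C)\<^sup>2 + 1))"
  have pos: "(A + C)\<^sup>2 + 1 > 0" by (simp add: add_nonneg_pos)
  have \<tau>1: "\<tau>1 > 0" "\<tau>1 * (A + C)\<^sup>2 \<le> \<tau> / 2"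
  proof -
    show "\<tau>1 > 0" unfolding \<tau>1_def using pos \<open>\<tau> > 0\<close> by simp
    then have "\<tau>1 * (A + C)\<^sup>2 \<le> \<tau>1 * ((A + C)\<^sup>2 + 1)" by (intro mult_left_mono) auto
    also have "\<dots> = \<tau> / 2" unfolding \<tau>1_def using pos by (simp add: field_simps)
    finally show "\<tau>1 * (A + C)\<^sup>2 \<le> \<tau> / 2" .
  qed
  obtain \<sigma>1 where \<sigma>1: "\<sigma>1 > 0"
    "\<And>y. \<bar>y\<bar> < \<sigma>1 \<Longrightarrow> F (s0 + y) \<ge> F s0 + F1 s0 * y + (F2 s0 / 2 - \<tau>1) * y\<^sup>2"
    using Taylor2_lower_bound[of \<rho> s0 F F1 F2 \<tau>1] assms(1-4) \<tau>1(1) by blast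
  \<comment> \<open>the cross terms in \<open>Y\<^sup>2 - (l w)\<^sup>2\<close> contribute at most \<open>H \<bar>w\<bar>\<^sup>3\<close>\<close>
  define H where "H = \<bar>F2 s0 / 2\<bar> * (C * (2 * A + C))"
  have H0: "H \<ge> 0" unfolding H_def using AC by simp
  define \<sigma> where "\<sigma> = min 1 (min (min \<sigma>1 \<rho> / (A + C + 1)) (\<tau> / (2 * (H + 1))))"
  have \<sigma>0: "\<sigma> > 0" unfolding \<sigma>_def using \<sigma>1 \<open>\<rho> > 0\<close> \<open>\<tau> > 0\<close> AC H0 by auto
  have "\<bar>l w + q w\<bar> < \<rho> \<and>
     F (s0 + (l w + q w)) \<ge> F s0 + F1 s0 * (l w + q w) + F2 s0 / 2 * (l w)\<^sup>2 - \<tau> * (norm w)\<^sup>2"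
    if w: "norm w < \<sigma>" for w
  proof -
    define n where "n = norm w"
    define Y where "Y = l w + q w"
    have n: "0 \<le> n" "n \<le> 1" "n * (A + C + 1) < min \<sigma>1 \<rho>" "n * (2 * (H + 1)) < \<tau>"
      using w AC H0 by (auto simp: \<sigma>_def n_def pos_less_divide_eq)
    have "C * n\<^sup>2 \<le> C * n"
      using n(1,2) AC by (intro mult_left_mono) (auto simp: power2_eq_square mult_left_le)
    then have Y: "\<bar>Y\<bar> \<le> (A + C) * n"
      using l[of w] q[of w] unfolding Y_def n_def by (simp add: algebra_simps)
    have Ysm: "\<bar>Y\<bar> < min \<sigma>1 \<rho>" using Y n by (simp add: algebra_simps)
    have Y2: "\<tau>1 * Y\<^sup>2 \<le> \<tau> / 2 * n\<^sup>2"
    proof -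
      have "Y\<^sup>2 \<le> ((A + C) * n)\<^sup>2" using Y n AC by (intro abs_le_square_iff[THEN iffD1]) simp
      then have "\<tau>1 * Y\<^sup>2 \<le> \<tau>1 * ((A + C) * n)\<^sup>2" using \<tau>1(1) by simp
      also have "\<dots> = (\<tau>1 * (A + C)\<^sup>2) * n\<^sup>2" by (simp add: power_mult_distrib)
      also have "\<dots> \<le> \<tau> / 2 * n\<^sup>2" using \<tau>1(2) by (intro mult_right_mono) auto
      finally show ?thesis .
    qed
    have cross: "F2 s0 / 2 * (Y\<^sup>2 - (l w)\<^sup>2) \<ge> - (\<tau> / 2 * n\<^sup>2)"
    proof -
      have "\<bar>2 * l w + q w\<bar> \<le> (2 * A + C) * n"
        using l[of w] q[of w] \<open>C * n\<^sup>2 \<le> C * n\<close> unfolding n_def by (simp add: algebra_simps)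
      then have "\<bar>q w\<bar> * \<bar>2 * l w + q w\<bar> \<le> (C * n\<^sup>2) * ((2 * A + C) * n)"
        using q[of w] AC n(1) unfolding n_def by (intro mult_mono) auto
      moreover have "Y\<^sup>2 - (l w)\<^sup>2 = q w * (2 * l w + q w)"
        unfolding Y_def by (simp add: power2_eq_square algebra_simps)
      ultimately have "\<bar>Y\<^sup>2 - (l w)\<^sup>2\<bar> \<le> (C * n\<^sup>2) * ((2 * A + C) * n)" by (simp add: abs_mult)
      then have "\<bar>F2 s0 / 2\<bar> * \<bar>Y\<^sup>2 - (l w)\<^sup>2\<bar> \<le> \<bar>F2 s0 / 2\<bar> * ((C * n\<^sup>2) * ((2 * A + C) * n))"
        by (rule mult_left_mono) simp
      also have "\<dots> = H * n * n\<^sup>2" unfolding H_def by simp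
      also have "\<dots> \<le> \<tau> / 2 * n\<^sup>2"
        using n(1,4) by (intro mult_right_mono) (simp_all add: algebra_simps)
      finally have "\<bar>F2 s0 / 2 * (Y\<^sup>2 - (l w)\<^sup>2)\<bar> \<le> \<tau> / 2 * n\<^sup>2" by (simp add: abs_mult)
      then show ?thesis by linarith
    qed
    have "F (s0 + Y) \<ge> F s0 + F1 s0 * Y + (F2 s0 / 2 - \<tau>1) * Y\<^sup>2"
      using Ysm by (intro \<sigma>1(2)) simp
    moreover have "(F2 s0 / 2 - \<tau>1) * Y\<^sup>2 = F2 s0 / 2 * (l w)\<^sup>2 + F2 s0 / 2 * (Y\<^sup>2 - (l w)\<^sup>2) - \<tau>1 * Y\<^sup>2"
      by (simp add: algebra_simps)
    ultimately show ?thesis using Y2 cross Ysm unfolding Y_def n_def by simp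
  qed
  then show ?thesis using \<sigma>0 by blast
qed

section \<open>The squared distance to a submanifold\<close>

text \<open>
  The span of \<open>B\<close> is the tangent space at \<open>e\<close>, the image of \<open>L\<close> under the derivative of the inverse
  chart \<open>h\<close>. Taylor's formula for \<open>h\<close>, together with a Lipschitz bound for \<open>g\<close>, shows that \<open>E\<close> deviates
  from it quadratically, with \<open>K\<close> uniform in \<open>e\<close>. If \<open>e\<close> is nearest to \<open>x\<close>, then differentiating the
  squared distance to \<open>x\<close> along curves in \<open>E\<close> shows that \<open>x - e\<close> is normal.
\<close>

lemma submanifold_tangent_approximation:
  fixes E :: "'a::euclidean_space set"
  assumes "smooth_closed_submanifold k E" and z: "z \<in> E"
  shows "\<exists>r>0. \<exists>K>0. \<forall>e\<in>E \<inter> ball z r. \<exists>B. finite B \<and> card B \<le> k \<and> pairwise orthogonal B \<and>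
     (\<forall>b\<in>B. norm b = 1) \<and>
     (\<forall>e'\<in>E \<inter> ball z r. \<exists>t\<in>span B. norm (e' - e - t) \<le> K * (norm (e' - e))\<^sup>2) \<and>
     (\<forall>x. (\<forall>e'\<in>E. dist x e \<le> dist x e') \<longrightarrow> (\<forall>b\<in>B. b \<bullet> (x - e) = 0))"
proof -
  obtain U V L :: "'a set" and g h where UV: "open U" "z \<in> U" "open V" and hom: "homeomorphism U V g h"
    and sm: "Cinf_on g U" "Cinf_on h V" and L: "subspace L" "dim L = k"
    and img: "g ` (U \<inter> E) = V \<inter> L"
    using bspec[OF conjunct2[OF assms(1)[unfolded smooth_closed_submanifold_def]] z]
    by blast
  have gV: "g x \<in> V" and hg: "h (g x) = x" if "x \<in> U" for x
    using hom that by (auto simp: homeomorphism_def)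
  let ?D = "\<lambda>y. frechet_derivative h (at y)"
  have D: "(h has_derivative ?D y) (at y)" if "y \<in> V" for y
  proof -
    have "Ck_on (Suc 0) h V" using sm unfolding Cinf_on_def by blast
    then show ?thesis using that by (auto simp: frechet_derivative_works)
  qed
  obtain r1 G where G: "r1 > 0" "G \<ge> 0" "ball z r1 \<subseteq> U"
      "\<And>x y. x \<in> ball z r1 \<Longrightarrow> y \<in> ball z r1 \<Longrightarrow> norm (g x - g y) \<le> G * norm (x - y)"
  proof -
    have "Ck_on (Suc 0) g U" using sm(1) unfolding Cinf_on_def by blast
    from C1_locally_Lipschitz[OF this UV(1,2)] show ?thesis by (elim exE conjE) (rule that; blast)
  qed
  obtain r2 C where C: "r2 > 0" "C \<ge> 0" "ball (g z) r2 \<subseteq> V"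
      "\<And>x y. x \<in> ball (g z) r2 \<Longrightarrow> y \<in> ball (g z) r2 \<Longrightarrow>
         norm (h y - h x - ?D x (y - x)) \<le> C * (norm (y - x))\<^sup>2"
  proof -
    have "Ck_on 2 h V" using sm(2) unfolding Cinf_on_def by blast
    from C2_first_order_Taylor[OF this UV(3) gV[OF UV(2)]] show ?thesis by (elim exE conjE) (rule that; blast)
  qed
  \<comment> \<open>small enough for \<open>g\<close> to map the ball around \<open>z\<close> into the one around \<open>g z\<close>\<close>
  define r where "r = min r1 (r2 / (G + 1))"
  have r: "r > 0" "r \<le> r1" using G C by (auto simp: r_def)
  have gball: "g x \<in> ball (g z) r2" if "x \<in> ball z r" for x
  proof -
    have "norm (g z - g x) \<le> G * norm (z - x)" using that r by (intro G(4)) auto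
    also have "\<dots> \<le> (G + 1) * norm (z - x)" by (simp add: mult_right_mono)
    also have "\<dots> < (G + 1) * r" using that G(2) by (intro mult_strict_left_mono) (auto simp: dist_norm)
    also have "\<dots> \<le> (G + 1) * (r2 / (G + 1))" using G(2) by (intro mult_left_mono) (auto simp: r_def)
    also have "\<dots> = r2" using G(2) by simp
    finally show ?thesis by (simp add: dist_norm)
  qed
  define K where "K = C * G\<^sup>2 + 1"
  have "\<exists>B. finite B \<and> card B \<le> k \<and> pairwise orthogonal B \<and> (\<forall>b\<in>B. norm b = 1) \<and>
     (\<forall>e'\<in>E \<inter> ball z r. \<exists>t\<in>span B. norm (e' - e - t) \<le> K * (norm (e' - e))\<^sup>2) \<and>
     (\<forall>x. (\<forall>e'\<in>E. dist x e \<le> dist x e') \<longrightarrow> (\<forall>b\<in>B. b \<bullet> (x - e) = 0))"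
    if e: "e \<in> E \<inter> ball z r" for e
  proof -
    have eU: "e \<in> U" using e r G by auto
    define y where "y = g e"
    have y: "y \<in> V" "y \<in> L" "h y = e" using img e eU hg by (auto simp: y_def)
    have linD: "linear (?D y)" using D[OF y(1)] has_derivative_linear by blast
    define T where "T = ?D y ` L"
    have "subspace T" unfolding T_def using linD L(1) by (rule linear_subspace_image)
    then obtain B where B: "B \<subseteq> T" "pairwise orthogonal B" "\<And>x. x \<in> B \<Longrightarrow> norm x = 1"
       "independent B" "card B = dim T" "span B = T"
      using orthonormal_basis_subspace by metis
    have "dim T \<le> k" unfolding T_def using dim_image_le[OF linD, of L] L(2) by simp
    moreover have "\<exists>t\<in>span B. norm (e' - e - t) \<le> K * (norm (e' - e))\<^sup>2" if e': "e' \<in> E \<inter> ball z r" for e'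
    proof -
      have e'U: "e' \<in> U" using e' r G by auto
      have y': "g e' \<in> L" "h (g e') = e'" using img e' e'U hg by auto
      have "norm (e' - e - ?D y (g e' - y)) \<le> C * (norm (g e' - y))\<^sup>2"
        using C(4)[of y "g e'"] y(3) y'(2) gball e e' by (auto simp: y_def)
      also have "\<dots> \<le> C * (G * norm (e' - e))\<^sup>2"
        unfolding y_def using e e' r C(2) by (intro mult_left_mono power_mono G(4)) auto
      also have "\<dots> \<le> K * (norm (e' - e))\<^sup>2"
        by (simp add: K_def power_mult_distrib algebra_simps)
      finally show ?thesis
        unfolding B(6) T_def using y'(1) y(2) L(1) by (intro bexI[of _ "?D y (g e' - y)"]) (auto simp: subspace_diff)
    qed
    moreover have "b \<bullet> (x - e) = 0" if x: "\<And>e'. e' \<in> E \<Longrightarrow> dist x e \<le> dist x e'" and b: "b \<in> B" for x b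
    proof -
      obtain l where l: "l \<in> L" "b = ?D y l" using b B(1) T_def by auto
      let ?F = "\<lambda>s. (x - h (y + s *\<^sub>R l)) \<bullet> (x - h (y + s *\<^sub>R l))"
      have D': "((\<lambda>s. h (y + s *\<^sub>R l)) has_derivative (\<lambda>s. ?D y (s *\<^sub>R l))) (at 0)"
        by (rule has_derivative_compose[of "\<lambda>s. y + s *\<^sub>R l" "\<lambda>s. s *\<^sub>R l" 0 UNIV h])
           (auto intro!: derivative_eq_intros D y)
      have "(?F has_derivative (\<lambda>s. - 2 * ((x - e) \<bullet> b) * s)) (at 0)"
        by (auto intro!: derivative_eq_intros D' simp: y(3) l(2) linear_scale[OF linD] inner_commute)
      then have der: "DERIV ?F 0 :> - 2 * ((x - e) \<bullet> b)"
        by (rule has_derivative_imp_has_field_derivative) simp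
      obtain \<rho> where \<rho>: "\<rho> > 0" "ball y \<rho> \<subseteq> V" using UV(3) y(1) openE by blast
      have "\<forall>s. \<bar>0 - s\<bar> < \<rho> / (norm l + 1) \<longrightarrow> ?F 0 \<le> ?F s"
      proof (intro allI impI)
        fix s :: real assume "\<bar>0 - s\<bar> < \<rho> / (norm l + 1)"
        then have "\<bar>s\<bar> * (norm l + 1) < \<rho>"
          by (subst (asm) pos_less_divide_eq) (auto simp: add_nonneg_pos)
        moreover have "\<bar>s\<bar> * norm l \<le> \<bar>s\<bar> * (norm l + 1)" by (simp add: mult_left_mono)
        ultimately have "norm (s *\<^sub>R l) < \<rho>" by simp
        then have "y + s *\<^sub>R l \<in> V" using \<rho>(2) by (auto simp: dist_norm)
        moreover have "y + s *\<^sub>R l \<in> L" using L(1) y(2) l(1) by (simp add: subspace_add subspace_scale)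
        ultimately obtain e' where "e' \<in> U \<inter> E" "y + s *\<^sub>R l = g e'" using img by blast
        then have "h (y + s *\<^sub>R l) \<in> E" using hg by auto
        from x[OF this] show "?F 0 \<le> ?F s"
          by (simp add: y(3) dist_norm norm_le)
      qed
      then have "- 2 * ((x - e) \<bullet> b) = 0"
        by (rule DERIV_local_min[OF der, rotated]) (use \<rho> in \<open>auto simp: add_nonneg_pos\<close>)
      then show ?thesis by (simp add: inner_commute)
    qed
    ultimately show ?thesis
      using B(2,3,4,5) by (intro exI[of _ B]) (auto simp: independent_imp_finite)
  qed
  moreover have "K > 0" unfolding K_def using C(2) by (simp add: add_nonneg_pos)
  ultimately show ?thesis using r(1) by blast
qed

lemma orthonormal_projection:
  fixes B :: "'a::real_inner set"
  assumes B: "finite B" "\<forall>b\<in>B. norm b = 1" "pairwise orthogonal B"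
  defines "P \<equiv> \<lambda>w. \<Sum>b\<in>B. (b \<bullet> w) *\<^sub>R b"
  shows "P (v - w) = P v - P w"
    and "t \<in> span B \<Longrightarrow> P t = t"
    and "(v - P v) \<bullet> P w = 0"
    and "(norm (P w))\<^sup>2 = (\<Sum>b\<in>B. (b \<bullet> w)\<^sup>2)"
    and "(norm v)\<^sup>2 = (norm (P v))\<^sup>2 + (norm (v - P v))\<^sup>2"
proof -
  have bb: "b \<bullet> c = (if b = c then 1 else 0)" if "b \<in> B" "c \<in> B" for b c
    using B that by (auto simp: norm_eq_1 pairwise_def orthogonal_def)
  have P_eq: "P w = (\<Sum>b\<in>B. (b \<bullet> w) *\<^sub>R b)" for w by (simp add: P_def)
  show diff: "P (v - w) = P v - P w" for v w
    unfolding P_def by (simp add: inner_diff_right scaleR_diff_left sum_subtractf)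
  have bP: "b \<bullet> P w = b \<bullet> w" if "b \<in> B" for b w
  proof -
    have "b \<bullet> P w = (\<Sum>c\<in>B. if c = b then c \<bullet> w else 0)"
      unfolding P_def inner_sum_right by (rule sum.cong) (auto simp: bb that)
    then show ?thesis using that B(1) by simp
  qed
  show orth: "(v - P v) \<bullet> P w = 0" for v w
    unfolding P_eq[of w] inner_sum_right
  proof (intro sum.neutral ballI)
    fix b assume "b \<in> B"
    then show "(v - P v) \<bullet> (b \<bullet> w) *\<^sub>R b = 0"
      using bP[of b v] by (simp add: inner_diff_left inner_commute[of v b] inner_commute[of "P v" b])
  qed
  have PP: "P w \<bullet> P w = (\<Sum>b\<in>B. (b \<bullet> w)\<^sup>2)"
    using inner_sum_left[of "\<lambda>b. (b \<bullet> w) *\<^sub>R b" B "P w"] bP unfolding P_eq[symmetric]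
    by (simp add: power2_eq_square)
  then show "(norm (P w))\<^sup>2 = (\<Sum>b\<in>B. (b \<bullet> w)\<^sup>2)" by (simp add: power2_norm_eq_inner)
  show "(norm v)\<^sup>2 = (norm (P v))\<^sup>2 + (norm (v - P v))\<^sup>2"
  proof -
    have "v \<bullet> v = ((v - P v) + P v) \<bullet> ((v - P v) + P v)" by simp
    also have "\<dots> = (v - P v) \<bullet> (v - P v) + 2 * ((v - P v) \<bullet> P v) + P v \<bullet> P v"
      using inner_commute[of "P v" "v - P v"] by (simp only: inner_add)
    finally show ?thesis using orth by (simp add: power2_norm_eq_inner)
  qed
  show "P t = t" if "t \<in> span B"
    using that
  proof (induction rule: span_induct_alt)
    case base then show ?case by (simp add: P_def)
  next
    case (step c b y)
    have "P (c *\<^sub>R b - (- y)) = P (c *\<^sub>R b) - P (- y)" by (rule diff)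
    moreover have "P (c *\<^sub>R b) = c *\<^sub>R b"
    proof -
      have "P (c *\<^sub>R b) = (\<Sum>d\<in>B. if d = b then c *\<^sub>R b else 0)"
        unfolding P_def by (rule sum.cong) (auto simp: bb step(1))
      then show ?thesis using step(1) B(1) by simp
    qed
    moreover have "P (- y) = - y"
      using diff[of 0 y] step(2) by (simp add: P_def)
    ultimately show ?case by simp
  qed
qed

text \<open>
  Only points \<open>e\<close> of \<open>E\<close> near \<open>e0\<close> compete for the distance from \<open>x\<close>, and for them \<open>e - e0\<close> has a
  tangential part \<open>s\<close> and a normal part \<open>m\<close> with \<open>\<bar>m\<bar> \<le> 2 K \<bar>s\<bar>\<^sup>2\<close>. With \<open>t\<close> and \<open>n\<close> for the
  two parts of \<open>x - e0\<close>, the squared distance \<open>\<bar>t - s\<bar>\<^sup>2 + \<bar>n - m\<bar>\<^sup>2\<close> is at least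
  \<open>\<bar>t - s\<bar>\<^sup>2 + \<bar>n\<bar>\<^sup>2 - 8 K d0 \<bar>s\<bar>\<^sup>2\<close>; the loss is compensated by the first term up to
  \<open>16 K d0 \<bar>t\<bar>\<^sup>2\<close>. This leaves the squared distance to the tangent space, lowered
  by a small tangential curvature term, and there is equality at \<open>x0\<close>.
\<close>

lemma dist_squared_lower_bound:
  fixes E :: "'a::euclidean_space set"
  assumes E: "closed E" and z: "z \<in> E" and e0: "e0 \<in> E"
    and B: "finite B" "\<forall>b\<in>B. norm b = 1" "pairwise orthogonal B"
    and tangent: "\<And>e. e \<in> E \<inter> ball z (2 * \<rho>) \<Longrightarrow> \<exists>t\<in>span B. norm (e - e0 - t) \<le> K * (norm (e - e0))\<^sup>2"
    and normal: "\<And>b. b \<in> B \<Longrightarrow> b \<bullet> (x0 - e0) = 0"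
    and K: "K > 0" "16 * K * \<rho> \<le> 1"
    and d0: "norm (x0 - e0) = d0" "d0 < \<rho>" "norm (x0 - z) < \<rho>"
    and x: "norm (x - z) < \<rho>" "norm (x - x0) \<le> d0"
  shows "(infdist x E)\<^sup>2 \<ge> d0\<^sup>2 + 2 * ((x0 - e0) \<bullet> (x - x0)) + (norm (x - x0))\<^sup>2
           - (1 + 16 * K * d0) * (\<Sum>b\<in>B. (b \<bullet> (x - x0))\<^sup>2)"
proof -
  define P where "P w = (\<Sum>b\<in>B. (b \<bullet> w) *\<^sub>R b)" for w
  note proj = orthonormal_projection[OF B, folded P_def]
  obtain e where e: "e \<in> E" "infdist x E = dist x e"
    using infdist_attains_inf[OF E, of x] z by blast
  define v where "v = x - e0"
  define t where "t = P v"
  define n where "n = v - t"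
  define s where "s = P (e - e0)"
  define m where "m = (e - e0) - s"
  have "dist x e \<le> dist x z" using e(2) infdist_le[OF z, of x] by simp
  then have xe: "norm (x - e) < \<rho>" using x(1) by (simp add: dist_norm)
  have ez: "norm (e - z) < 2 * \<rho>"
    using norm_triangle_ineq4[of "x - z" "x - e"] x(1) xe by simp
  have "norm (e - e0) = norm (((e - z) - (x0 - z)) + (x0 - e0))" by simp
  also have "\<dots> \<le> norm ((e - z) - (x0 - z)) + norm (x0 - e0)" by (rule norm_triangle_ineq)
  also have "\<dots> \<le> (norm (e - z) + norm (x0 - z)) + norm (x0 - e0)"
    by (intro add_right_mono norm_triangle_ineq4)
  finally have ee0: "norm (e - e0) < 4 * \<rho>" using ez d0 by simp
  have me: "norm m \<le> norm (e - e0)"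
  proof -
    have "(norm (e - e0))\<^sup>2 = (norm s)\<^sup>2 + (norm m)\<^sup>2" unfolding s_def m_def by (rule proj(5))
    then show ?thesis by (simp add: power2_le_imp_le)
  qed
  \<comment> \<open>\<open>K \<bar>m\<bar> \<le> 1 / 2\<close> lets the tangency estimate absorb its own normal part\<close>
  have m2: "norm m \<le> 2 * K * (norm s)\<^sup>2"
  proof -
    have "e \<in> E \<inter> ball z (2 * \<rho>)" using e(1) ez by (simp add: dist_norm norm_minus_commute[of z e])
    then obtain t' where t': "t' \<in> span B" "norm (e - e0 - t') \<le> K * (norm (e - e0))\<^sup>2"
      using bexE[OF tangent] by metis
    have "m = (e - e0 - t') - P (e - e0 - t')"
      unfolding m_def s_def proj(1)[of "e - e0" t'] proj(2)[OF t'(1)] by simp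
    then have "(norm (e - e0 - t'))\<^sup>2 = (norm (P (e - e0 - t')))\<^sup>2 + (norm m)\<^sup>2"
      using proj(5)[of "e - e0 - t'"] by simp
    then have "norm m \<le> norm (e - e0 - t')" by (simp add: power2_le_imp_le)
    also have "\<dots> \<le> K * (norm (e - e0))\<^sup>2" by (rule t'(2))
    also have "(norm (e - e0))\<^sup>2 = (norm s)\<^sup>2 + (norm m)\<^sup>2" unfolding s_def m_def by (rule proj(5))
    finally have 1: "norm m \<le> K * (norm s)\<^sup>2 + (K * norm m) * norm m"
      by (simp add: power2_eq_square algebra_simps)
    have "K * norm m \<le> K * (4 * \<rho>)" using me ee0 K(1) by (intro mult_left_mono) auto
    also have "\<dots> \<le> 1 / 2" using K(2) K(1) by (simp add: algebra_simps)
    finally have "(K * norm m) * norm m \<le> 1 / 2 * norm m" by (rule mult_right_mono) simp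
    then show ?thesis using 1 by simp
  qed
  have d0': "d0 \<ge> 0" using d0(1) by auto
  have "norm v \<le> norm (x - x0) + norm (x0 - e0)"
    unfolding v_def using norm_triangle_ineq[of "x - x0" "x0 - e0"] by simp
  then have v2: "norm v \<le> 2 * d0" using x(2) d0(1) by simp
  have vn: "(norm v)\<^sup>2 = (norm t)\<^sup>2 + (norm n)\<^sup>2" unfolding n_def t_def by (rule proj(5))
  then have "norm n \<le> norm v" by (simp add: power2_le_imp_le)
  with v2 have n2: "norm n \<le> 2 * d0" by simp
  have Kd: "8 * K * d0 \<le> 1 / 2" 
  proof -
    have "K * d0 \<le> K * \<rho>" using K(1) d0(2) by simp
    then show ?thesis using K(2) by simp
  qed
  have split: "(norm (x - e))\<^sup>2 = (norm (t - s))\<^sup>2 + (norm (n - m))\<^sup>2"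
  proof -
    have "x - e = v - (e - e0)" by (simp add: v_def)
    moreover have "P (v - (e - e0)) = t - s" unfolding t_def s_def by (rule proj(1))
    moreover have "v - (e - e0) - (t - s) = n - m" by (simp add: n_def m_def)
    ultimately show ?thesis using proj(5)[of "v - (e - e0)"] by metis
  qed
  have "(norm (n - m))\<^sup>2 = (norm n)\<^sup>2 - 2 * (n \<bullet> m) + (norm m)\<^sup>2"
    by (simp add: power2_norm_eq_inner inner_diff inner_commute[of m n])
  moreover have "n \<bullet> m \<le> (2 * d0) * (2 * K * (norm s)\<^sup>2)"
  proof -
    have "n \<bullet> m \<le> norm n * norm m" by (rule norm_cauchy_schwarz)
    also have "\<dots> \<le> (2 * d0) * (2 * K * (norm s)\<^sup>2)" using n2 m2 d0' by (intro mult_mono) auto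
    finally show ?thesis .
  qed
  ultimately have "(norm (n - m))\<^sup>2 \<ge> (norm n)\<^sup>2 - 2 * ((2 * d0) * (2 * K * (norm s)\<^sup>2))"
    using zero_le_power2[of "norm m"] by linarith
  then have nm: "(norm (n - m))\<^sup>2 \<ge> (norm n)\<^sup>2 - 8 * K * d0 * (norm s)\<^sup>2"
    by (simp add: algebra_simps)
  have "(norm s)\<^sup>2 \<le> 2 * (norm (t - s))\<^sup>2 + 2 * (norm t)\<^sup>2"
  proof -
    have "0 \<le> (norm (2 *\<^sub>R t - s))\<^sup>2" by simp
    also have "\<dots> = 2 * (norm (t - s))\<^sup>2 + 2 * (norm t)\<^sup>2 - (norm s)\<^sup>2"
      by (simp add: power2_norm_eq_inner inner_diff inner_commute[of s t])
    finally show ?thesis by simp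
  qed
  then have "8 * K * d0 * (norm s)\<^sup>2 \<le> 8 * K * d0 * (2 * (norm (t - s))\<^sup>2 + 2 * (norm t)\<^sup>2)"
    using K(1) d0' by (intro mult_left_mono) auto
  also have "\<dots> = 2 * (8 * K * d0) * (norm (t - s))\<^sup>2 + 16 * K * d0 * (norm t)\<^sup>2"
    by (simp add: algebra_simps)
  also have "\<dots> \<le> 1 * (norm (t - s))\<^sup>2 + 16 * K * d0 * (norm t)\<^sup>2"
    using Kd by (intro add_right_mono mult_right_mono) auto
  finally have "(norm (x - e))\<^sup>2 \<ge> (norm n)\<^sup>2 - 16 * K * d0 * (norm t)\<^sup>2"
    using split nm by simp
  then have "(norm (x - e))\<^sup>2 \<ge> (norm v)\<^sup>2 - (1 + 16 * K * d0) * (norm t)\<^sup>2"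
    using vn by (simp add: algebra_simps)
  moreover have "(norm v)\<^sup>2 = d0\<^sup>2 + 2 * ((x0 - e0) \<bullet> (x - x0)) + (norm (x - x0))\<^sup>2"
  proof -
    have "v = (x0 - e0) + (x - x0)" by (simp add: v_def)
    then show ?thesis unfolding d0(1)[symmetric]
      using inner_commute[of "x - x0" "x0 - e0"] by (simp only: power2_norm_eq_inner inner_add)
  qed
  moreover have "(norm t)\<^sup>2 = (\<Sum>b\<in>B. (b \<bullet> (x - x0))\<^sup>2)"
  proof -
    have "b \<bullet> v = b \<bullet> (x - x0)" if "b \<in> B" for b
      using normal[OF that] by (simp add: v_def inner_diff_right)
    then show ?thesis unfolding t_def proj(4) by simp
  qed
  ultimately show ?thesis using e(2) by (simp add: dist_norm)
qed

section \<open>The barrier\<close>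

text \<open>
  Applied to \<open>s = d\<^sup>2\<close>, the function \<open>F s = \<epsilon> sqrt s + (\<delta> / 2) ln s\<close> gives \<open>\<epsilon> d + \<delta> ln d\<close>. It is
  increasing, so a lower bound for \<open>d\<^sup>2\<close> transfers. The constants are \<open>p = F' (d0\<^sup>2)\<close> and
  \<open>\<gamma> = - 2 F'' (d0\<^sup>2)\<close>; the latter comes from the square of the linear part \<open>2 (y \<bullet> (x - x0))\<close>.
\<close>

lemma sqrt_plus_log_quadratic_lower_bound:
  fixes D :: "'a::real_inner \<Rightarrow> real" and y x0 :: 'a
  assumes B: "finite B" "\<forall>b\<in>B. norm b = 1"
    and d0: "norm y = d0" "d0 > 0" and pos: "\<epsilon> > 0" "\<delta> > 0" "c \<ge> 0" "\<sigma>0 > 0"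
    and D0: "D x0 = d0"
    and D: "\<And>x. norm (x - x0) < \<sigma>0 \<Longrightarrow> D x > 0 \<and>
       (D x)\<^sup>2 \<ge> d0\<^sup>2 + 2 * (y \<bullet> (x - x0)) + (norm (x - x0))\<^sup>2 - c * (\<Sum>b\<in>B. (b \<bullet> (x - x0))\<^sup>2)"
  defines "p \<equiv> \<epsilon> / (2 * d0) + \<delta> / (2 * d0\<^sup>2)"
    and "\<gamma> \<equiv> \<epsilon> / (2 * d0 ^ 3) + \<delta> / d0 ^ 4"
  shows "\<exists>\<sigma>>0. \<forall>x. norm (x - x0) < \<sigma> \<longrightarrow>
    \<epsilon> * D x + \<delta> * ln (D x) \<ge> \<epsilon> * d0 + \<delta> * ln d0
      + p * (2 * (y \<bullet> (x - x0)) + (norm (x - x0))\<^sup>2 - c * (\<Sum>b\<in>B. (b \<bullet> (x - x0))\<^sup>2))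
      - \<gamma> * (y \<bullet> (x - x0))\<^sup>2 - (norm (x - x0))\<^sup>2"
proof -
  define F where "F s = \<epsilon> * sqrt s + \<delta> / 2 * ln s" for s
  define F1 where "F1 s = \<epsilon> / (2 * sqrt s) + \<delta> / (2 * s)" for s
  define F2 where "F2 s = - \<epsilon> / (4 * (s * sqrt s)) - \<delta> / (2 * s\<^sup>2)" for s
  define l where "l w = 2 * (y \<bullet> w)" for w
  define q where "q w = (norm w)\<^sup>2 - c * (\<Sum>b\<in>B. (b \<bullet> w)\<^sup>2)" for w
  have d1: "DERIV F s :> F1 s" if "s > 0" for s
    unfolding F_def[abs_def] F1_def using that
    by (auto intro!: derivative_eq_intros simp: field_simps)
  have d2: "DERIV F1 s :> F2 s" if "s > 0" for s
    unfolding F1_def[abs_def] F2_def using that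
    by (auto intro!: derivative_eq_intros simp: field_simps power2_eq_square real_sqrt_mult_self)
  have l: "\<bar>l w\<bar> \<le> (2 * d0) * norm w" for w
    unfolding l_def using Cauchy_Schwarz_ineq2[of y w] d0(1) by (simp add: abs_mult)
  have q: "\<bar>q w\<bar> \<le> (1 + c * card B) * (norm w)\<^sup>2" for w
  proof -
    have "(b \<bullet> w)\<^sup>2 \<le> (norm w)\<^sup>2" if "b \<in> B" for b
    proof -
      have "\<bar>b \<bullet> w\<bar> \<le> norm w" using Cauchy_Schwarz_ineq2[of b w] B(2) that by simp
      then show ?thesis by (simp add: abs_le_square_iff[symmetric])
    qed
    then have "(\<Sum>b\<in>B. (b \<bullet> w)\<^sup>2) \<le> card B * (norm w)\<^sup>2"
      using sum_bounded_above[of B "\<lambda>b. (b \<bullet> w)\<^sup>2" "(norm w)\<^sup>2"] by simp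
    then have "c * (\<Sum>b\<in>B. (b \<bullet> w)\<^sup>2) \<le> c * (card B * (norm w)\<^sup>2)" using pos(3) by (rule mult_left_mono)
    moreover have "c * (\<Sum>b\<in>B. (b \<bullet> w)\<^sup>2) \<ge> 0" using pos(3) by (simp add: sum_nonneg)
    ultimately have "\<bar>q w\<bar> \<le> (norm w)\<^sup>2 + c * (card B * (norm w)\<^sup>2)"
      unfolding q_def using zero_le_power2[of "norm w"] by linarith
    then show ?thesis by (simp add: algebra_simps)
  qed
  have "\<exists>\<sigma>>0. \<forall>w. norm w < \<sigma> \<longrightarrow> \<bar>l w + q w\<bar> < d0\<^sup>2 \<and>
     F (d0\<^sup>2 + (l w + q w)) \<ge> F (d0\<^sup>2) + F1 (d0\<^sup>2) * (l w + q w) + F2 (d0\<^sup>2) / 2 * (l w)\<^sup>2 - 1 * (norm w)\<^sup>2"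
  proof (rule Taylor2_lower_bound_composed[where F = F and ?F1.0 = F1 and ?F2.0 = F2 and A = "2 * d0" and C = "1 + c * card B"])
    show "DERIV F s :> F1 s" if "\<bar>s - d0\<^sup>2\<bar> < d0\<^sup>2" for s using that by (intro d1) auto
    show "DERIV F1 s :> F2 s" if "\<bar>s - d0\<^sup>2\<bar> < d0\<^sup>2" for s using that by (intro d2) auto
    show "isCont F2 (d0\<^sup>2)"
      unfolding F2_def[abs_def] using d0(2) by (intro continuous_intros) auto
  qed (use d0(2) pos(3) l q in auto)
  then obtain \<sigma> where \<sigma>: "\<sigma> > 0" "\<And>w. norm w < \<sigma> \<Longrightarrow> \<bar>l w + q w\<bar> < d0\<^sup>2"
    "\<And>w. norm w < \<sigma> \<Longrightarrow> F (d0\<^sup>2 + (l w + q w)) \<ge> F (d0\<^sup>2) + F1 (d0\<^sup>2) * (l w + q w) + F2 (d0\<^sup>2) / 2 * (l w)\<^sup>2 - 1 * (norm w)\<^sup>2"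
    by blast
  have Fsq: "F (s\<^sup>2) = \<epsilon> * s + \<delta> * ln s" if "s > 0" for s
    using that by (simp add: F_def ln_realpow)
  have F1p: "F1 (d0\<^sup>2) = p" using d0(2) by (simp add: F1_def p_def)
  have F2g: "F2 (d0\<^sup>2) / 2 * (l w)\<^sup>2 = - \<gamma> * (y \<bullet> w)\<^sup>2" for w
    using d0(2) by (simp add: F2_def \<gamma>_def l_def field_simps power2_eq_square power3_eq_cube power4_eq_xxxx)
  have "\<epsilon> * D x + \<delta> * ln (D x) \<ge> \<epsilon> * d0 + \<delta> * ln d0 + p * (l (x - x0) + q (x - x0)) - \<gamma> * (y \<bullet> (x - x0))\<^sup>2 - (norm (x - x0))\<^sup>2"
    if x: "norm (x - x0) < min \<sigma> \<sigma>0" for x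
  proof -
    let ?s = "d0\<^sup>2 + (l (x - x0) + q (x - x0))"
    have xs: "norm (x - x0) < \<sigma>" "norm (x - x0) < \<sigma>0" using x by auto
    have s: "?s > 0" using \<sigma>(2)[OF xs(1)] by auto
    have Ds: "?s \<le> (D x)\<^sup>2" "D x > 0" using D[OF xs(2)] by (auto simp: l_def q_def)
    have "sqrt ?s \<le> sqrt ((D x)\<^sup>2)" "ln ?s \<le> ln ((D x)\<^sup>2)"
      using s Ds(1) real_sqrt_le_mono ln_mono by blast+
    then have "F ?s \<le> F ((D x)\<^sup>2)"
      unfolding F_def using pos by (intro add_mono mult_left_mono) auto
    also have "\<dots> = \<epsilon> * D x + \<delta> * ln (D x)" by (rule Fsq[OF Ds(2)])
    finally show ?thesis
      using \<sigma>(3)[OF xs(1)] unfolding F1p F2g Fsq[OF d0(2)] by simp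
  qed
  then show ?thesis using \<sigma>(1) pos(4)
    by (intro exI[of _ "min \<sigma> \<sigma>0"]) (auto simp: l_def q_def algebra_simps)
qed

text \<open>
  At points of \<open>E\<close> the value is determined by \<open>ln 0 = 0\<close> and has no meaning; the barrier is only
  used off \<open>E\<close>, where the logarithm tends to \<open>-\<infinity>\<close> on approaching \<open>E\<close>.
\<close>

definition barrier :: "(real ^ 'n \<Rightarrow> real) \<Rightarrow> real \<Rightarrow> real \<Rightarrow> (real ^ 'n) set \<Rightarrow> real ^ 'n \<Rightarrow> real ^ 'n \<Rightarrow> real"
  where "barrier \<eta> \<epsilon> \<delta> E z x =
    \<epsilon> * infdist x E + \<delta> * ln (infdist x E) - \<eta> x - (norm (x - z))\<^sup>2"

text \<open>
  The smooth part \<open>\<eta>\<close> enters only through its first-order expansion, at the cost of \<open>C \<bar>x - x0\<bar>\<^sup>2\<close>;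
  this keeps the second-order part explicit and symmetric. Of the coefficient \<open>C + 2\<close>, one unit comes from
  \<open>\<bar>x - z\<bar>\<^sup>2\<close> and one from the Taylor remainder of the distance part.
  The vector \<open>y\<close> is \<open>x0 - e0\<close> for a nearest point \<open>e0\<close>, and \<open>B\<close> spans the tangent space there.
\<close>

lemma barrier_quadratic_lower_bound:
  fixes \<Omega> E :: "(real ^ 'n) set"
  assumes E: "smooth_closed_submanifold k E" and \<Omega>: "open \<Omega>" "E \<subseteq> \<Omega>"
    and z: "z \<in> E" and \<eta>: "Ck_on 2 \<eta> \<Omega>" and \<epsilon>: "\<epsilon> > 0"
  shows "\<exists>\<rho>>0. \<exists>K>0. \<exists>C\<ge>0. ball z \<rho> \<subseteq> \<Omega> \<and>
    (\<forall>\<delta>>0. \<forall>x0\<in>ball z \<rho> - E. \<exists>d0 y B. infdist x0 E = d0 \<and> 0 < d0 \<and> norm y = d0 \<and>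
      finite B \<and> card B \<le> k \<and> (\<forall>b\<in>B. norm b = 1) \<and>
      (\<exists>a. \<exists>\<sigma>>0. \<forall>x\<in>ball x0 \<sigma>. barrier \<eta> \<epsilon> \<delta> E z x \<ge> barrier \<eta> \<epsilon> \<delta> E z x0 + a \<bullet> (x - x0)
        + (\<epsilon> / (2 * d0) + \<delta> / (2 * d0\<^sup>2)) *
            ((norm (x - x0))\<^sup>2 - (1 + 16 * K * d0) * (\<Sum>b\<in>B. (b \<bullet> (x - x0))\<^sup>2))
        - (\<epsilon> / (2 * d0 ^ 3) + \<delta> / d0 ^ 4) * (y \<bullet> (x - x0))\<^sup>2 - (C + 2) * (norm (x - x0))\<^sup>2))"
proof -
  have clE: "closed E" using E by (auto simp: smooth_closed_submanifold_def compact_imp_closed)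
  have neE: "E \<noteq> {}" using z by blast
  obtain r K where K: "r > 0" "K > 0" and tang:
     "\<forall>e\<in>E \<inter> ball z r. \<exists>B. finite B \<and> card B \<le> k \<and> pairwise orthogonal B \<and>
     (\<forall>b\<in>B. norm b = 1) \<and>
     (\<forall>e'\<in>E \<inter> ball z r. \<exists>t\<in>span B. norm (e' - e - t) \<le> K * (norm (e' - e))\<^sup>2) \<and>
     (\<forall>x. (\<forall>e'\<in>E. dist x e \<le> dist x e') \<longrightarrow> (\<forall>b\<in>B. b \<bullet> (x - e) = 0))"
    using submanifold_tangent_approximation[OF E z] by blast
  have z\<Omega>: "z \<in> \<Omega>" using z \<Omega>(2) by blast
  obtain r' C where C: "r' > 0" "C \<ge> 0" "ball z r' \<subseteq> \<Omega>" and tay: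
    "\<And>x y. x \<in> ball z r' \<Longrightarrow> y \<in> ball z r' \<Longrightarrow>
       norm (\<eta> y - \<eta> x - frechet_derivative \<eta> (at x) (y - x)) \<le> C * (norm (y - x))\<^sup>2"
    using C2_first_order_Taylor[OF \<eta> \<Omega>(1) z\<Omega>] by blast
  \<comment> \<open>the nearest point of \<open>E\<close> lies within twice the radius, hence \<open>r / 2\<close>\<close>
  define \<rho> where "\<rho> = min (r / 2) (min r' (1 / (16 * K)))"
  have \<rho>: "\<rho> > 0" "2 * \<rho> \<le> r" "\<rho> \<le> r'" "\<rho> \<le> 1 / (16 * K)"
    using K C by (auto simp: \<rho>_def min_def)
  have K\<rho>: "16 * K * \<rho> \<le> 1" using \<rho>(4) K(2) by (simp add: field_simps)
  have main: "\<exists>d0 y B. infdist x0 E = d0 \<and> 0 < d0 \<and> norm y = d0 \<and>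
      finite B \<and> card B \<le> k \<and> (\<forall>b\<in>B. norm b = 1) \<and>
      (\<exists>a. \<exists>\<sigma>>0. \<forall>x\<in>ball x0 \<sigma>. barrier \<eta> \<epsilon> \<delta> E z x \<ge> barrier \<eta> \<epsilon> \<delta> E z x0 + a \<bullet> (x - x0)
        + (\<epsilon> / (2 * d0) + \<delta> / (2 * d0\<^sup>2)) *
            ((norm (x - x0))\<^sup>2 - (1 + 16 * K * d0) * (\<Sum>b\<in>B. (b \<bullet> (x - x0))\<^sup>2))
        - (\<epsilon> / (2 * d0 ^ 3) + \<delta> / d0 ^ 4) * (y \<bullet> (x - x0))\<^sup>2 - (C + 2) * (norm (x - x0))\<^sup>2)"
    if \<delta>: "\<delta> > 0" and x0: "x0 \<in> ball z \<rho>" "x0 \<notin> E" for \<delta> x0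
  proof -
    obtain e0 where e0: "e0 \<in> E" "infdist x0 E = dist x0 e0"
      using infdist_attains_inf[OF clE neE, of x0] by blast
    define y where "y = x0 - e0"
    define d0 where "d0 = norm y"
    have d0: "infdist x0 E = d0" "d0 > 0" using e0 x0(2) by (auto simp: d0_def y_def dist_norm)
    have x0z: "norm (x0 - z) < \<rho>" using x0(1) by (simp add: dist_norm norm_minus_commute)
    have d0\<rho>: "d0 < \<rho>" using infdist_le[OF z, of x0] d0(1) x0z by (simp add: dist_norm)
    have "norm (e0 - z) < 2 * \<rho>"
      using norm_triangle_ineq4[of "x0 - z" "x0 - e0"] x0z d0\<rho> by (simp add: d0_def y_def)
    then have e0r: "e0 \<in> E \<inter> ball z r" using e0(1) \<rho>(2) by (simp add: dist_norm norm_minus_commute[of z e0])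
    obtain B where B: "finite B" "card B \<le> k" "pairwise orthogonal B" "\<forall>b\<in>B. norm b = 1"
      and Bt: "\<forall>e'\<in>E \<inter> ball z r. \<exists>t\<in>span B. norm (e' - e0 - t) \<le> K * (norm (e' - e0))\<^sup>2"
      and Bn: "\<forall>x. (\<forall>e'\<in>E. dist x e0 \<le> dist x e') \<longrightarrow> (\<forall>b\<in>B. b \<bullet> (x - e0) = 0)"
      using bspec[OF tang e0r] by (elim exE conjE) (rule that, assumption+)
    have "\<forall>e'\<in>E. dist x0 e0 \<le> dist x0 e'" using infdist_le[of _ E x0] e0(2) by simp
    with Bn have normal: "\<forall>b\<in>B. b \<bullet> (x0 - e0) = 0" by blast
    define c where "c = 1 + 16 * K * d0"
    define p where "p = \<epsilon> / (2 * d0) + \<delta> / (2 * d0\<^sup>2)"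
    define g where "g = \<epsilon> / (2 * d0 ^ 3) + \<delta> / d0 ^ 4"
    define S where "S x = (\<Sum>b\<in>B. (b \<bullet> (x - x0))\<^sup>2)" for x
    define \<sigma>0 where "\<sigma>0 = min d0 (\<rho> - norm (x0 - z))"
    have \<sigma>0: "\<sigma>0 > 0" using d0(2) x0z by (simp add: \<sigma>0_def)
    have close: "norm (x - z) < \<rho>" "norm (x - x0) < d0" if "norm (x - x0) < \<sigma>0" for x
      using that norm_triangle_ineq[of "x - x0" "x0 - z"] by (auto simp: \<sigma>0_def)
    have D: "infdist x E > 0 \<and> (infdist x E)\<^sup>2 \<ge> d0\<^sup>2 + 2 * (y \<bullet> (x - x0)) + (norm (x - x0))\<^sup>2
       - c * (\<Sum>b\<in>B. (b \<bullet> (x - x0))\<^sup>2)" if x: "norm (x - x0) < \<sigma>0" for x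
    proof
      have "infdist x0 E \<le> infdist x E + dist x0 x" by (rule infdist_triangle)
      then show "infdist x E > 0" using close(2)[OF x] d0(1) by (simp add: dist_norm norm_minus_commute)
      show "(infdist x E)\<^sup>2 \<ge> d0\<^sup>2 + 2 * (y \<bullet> (x - x0)) + (norm (x - x0))\<^sup>2
         - c * (\<Sum>b\<in>B. (b \<bullet> (x - x0))\<^sup>2)"
        unfolding y_def c_def
      proof (rule dist_squared_lower_bound[OF clE z e0(1) B(1,4,3)])
        show "\<exists>t\<in>span B. norm (e - e0 - t) \<le> K * (norm (e - e0))\<^sup>2" if "e \<in> E \<inter> ball z (2 * \<rho>)" for e
          using that \<rho>(2) Bt by auto
        show "norm (x - x0) \<le> d0" using close(2)[OF x] by simp
      qed (use normal K(2) K\<rho> d0\<rho> x0z close(1)[OF x] in \<open>auto simp: d0_def y_def\<close>)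
    qed
    obtain \<sigma> where \<sigma>: "\<sigma> > 0" and dist_part: "\<And>x. norm (x - x0) < \<sigma> \<Longrightarrow>
       \<epsilon> * infdist x E + \<delta> * ln (infdist x E) \<ge> \<epsilon> * d0 + \<delta> * ln d0
        + p * (2 * (y \<bullet> (x - x0)) + (norm (x - x0))\<^sup>2 - c * S x)
        - g * (y \<bullet> (x - x0))\<^sup>2 - (norm (x - x0))\<^sup>2"
      using sqrt_plus_log_quadratic_lower_bound[OF B(1,4) d0_def[symmetric] d0(2) \<epsilon> \<delta> _ \<sigma>0 d0(1) D] K(2) d0(2)
      unfolding p_def g_def S_def c_def by auto
    have x0r: "x0 \<in> ball z r'" using x0(1) \<rho>(3) by simp
    have lin: "linear (frechet_derivative \<eta> (at x0))"
    proof -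
      have "\<eta> differentiable (at x0)" using \<eta> x0r C(3) by (auto simp: numeral_2_eq_2)
      then show ?thesis by (rule linear_frechet_derivative)
    qed
    define G where "G = adjoint (frechet_derivative \<eta> (at x0)) 1"
    have G: "frechet_derivative \<eta> (at x0) w = G \<bullet> w" for w
      using adjoint_works[OF lin, of w 1] by (simp add: G_def inner_commute)
    define a where "a = (2 * p) *\<^sub>R y - G - 2 *\<^sub>R (x0 - z)"
    have "barrier \<eta> \<epsilon> \<delta> E z x \<ge> barrier \<eta> \<epsilon> \<delta> E z x0 + a \<bullet> (x - x0)
        + p * ((norm (x - x0))\<^sup>2 - c * S x) - g * (y \<bullet> (x - x0))\<^sup>2 - (C + 2) * (norm (x - x0))\<^sup>2"
      if x: "x \<in> ball x0 (min \<sigma> \<sigma>0)" for x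
    proof -
      have xs: "norm (x - x0) < \<sigma>" "norm (x - x0) < \<sigma>0" using x by (auto simp: dist_norm norm_minus_commute)
      have "x \<in> ball z r'" using close(1)[OF xs(2)] \<rho>(3) by (simp add: dist_norm norm_minus_commute)
      from tay[OF x0r this] have "\<eta> x \<le> \<eta> x0 + G \<bullet> (x - x0) + C * (norm (x - x0))\<^sup>2"
        unfolding G by (simp add: abs_le_iff)
      moreover have "(norm (x - z))\<^sup>2 = (norm (x0 - z))\<^sup>2 + 2 * ((x0 - z) \<bullet> (x - x0)) + (norm (x - x0))\<^sup>2"
      proof -
        have "x - z = (x0 - z) + (x - x0)" by simp
        then show ?thesis
          using inner_commute[of "x - x0" "x0 - z"] by (simp only: power2_norm_eq_inner inner_add)
      qed
      moreover have "a \<bullet> (x - x0) = p * (2 * (y \<bullet> (x - x0))) - G \<bullet> (x - x0) - 2 * ((x0 - z) \<bullet> (x - x0))"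
        unfolding a_def by (simp add: inner_diff_left)
      ultimately show ?thesis
        using dist_part[OF xs(1)] unfolding barrier_def d0(1) by (simp add: algebra_simps)
    qed
    then have "\<exists>a. \<exists>\<sigma>>0. \<forall>x\<in>ball x0 \<sigma>. barrier \<eta> \<epsilon> \<delta> E z x \<ge> barrier \<eta> \<epsilon> \<delta> E z x0 + a \<bullet> (x - x0)
        + p * ((norm (x - x0))\<^sup>2 - c * S x) - g * (y \<bullet> (x - x0))\<^sup>2 - (C + 2) * (norm (x - x0))\<^sup>2"
      using \<sigma> \<sigma>0 by (intro exI[of _ a] exI[of _ "min \<sigma> \<sigma>0"]) simp
    then show ?thesis
      unfolding p_def c_def S_def g_def using d0 d0_def B
      by (intro exI[of _ d0] exI[of _ y] exI[of _ B]) simp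
  qed
  have "ball z \<rho> \<subseteq> \<Omega>" using C(3) \<rho>(3) by auto
  show ?thesis
    by (rule exI[of _ \<rho>], rule conjI[OF \<rho>(1)], rule exI[of _ K], rule conjI[OF K(2)],
        rule exI[of _ C], rule conjI[OF C(2)], rule conjI[OF \<open>ball z \<rho> \<subseteq> \<Omega>\<close>],
        intro allI impI ballI, rule main) auto
qed

text \<open>
  The quadratic polynomial below the barrier would be a test function whose Hessian is twice
  \<open>\<alpha> I - \<beta> P - \<gamma> y \<otimes> y\<close>, with \<open>P\<close> the tangential projection. Its trace over any \<open>k + 2\<close>
  orthonormal vectors is at least twice
  \<open>\<alpha> (k + 2) - \<beta> k - \<gamma> d0\<^sup>2 = \<epsilon> / (2 d0) - 8 K k \<delta> / d0 - H\<close>. The two terms in \<open>\<delta> / d0\<^sup>2\<close> cancel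
  exactly, and what is left is positive when \<open>\<delta>\<close> is small compared with \<open>\<epsilon>\<close> and \<open>d0\<close> is small
  compared with \<open>\<epsilon> / H\<close>.
\<close>

lemma barrier_touches_nowhere:
  fixes \<Omega> E :: "(real ^ 'n) set"
  assumes E: "smooth_closed_submanifold k E" and \<Omega>: "open \<Omega>" "E \<subseteq> \<Omega>"
    and z: "z \<in> E" and \<eta>: "Ck_on 2 \<eta> \<Omega>" and \<epsilon>: "\<epsilon> > 0"
    and k: "k + 2 \<le> CARD('n)" and visc: "visc_eigval_sum_nonpos (k + 2) (\<Omega> - E) u"
  shows "\<exists>\<rho>>0. ball z \<rho> \<subseteq> \<Omega> \<and> (\<exists>\<delta>1>0. \<forall>\<delta>>0. \<delta> \<le> \<delta>1 \<longrightarrow>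
    (\<forall>x0\<in>ball z \<rho> - E. \<forall>\<sigma>>0. \<exists>x\<in>ball x0 \<sigma> \<inter> (\<Omega> - E).
       u x - barrier \<eta> \<epsilon> \<delta> E z x < u x0 - barrier \<eta> \<epsilon> \<delta> E z x0))"
proof -
  obtain \<rho>0 K C where \<rho>0: "\<rho>0 > 0" and K: "K > 0" and C: "C \<ge> 0" and sub: "ball z \<rho>0 \<subseteq> \<Omega>"
    and low: "\<forall>\<delta>>0. \<forall>x0\<in>ball z \<rho>0 - E. \<exists>d0 y B. infdist x0 E = d0 \<and> 0 < d0 \<and> norm y = d0 \<and>
      finite B \<and> card B \<le> k \<and> (\<forall>b\<in>B. norm b = 1) \<and>
      (\<exists>a. \<exists>\<sigma>>0. \<forall>x\<in>ball x0 \<sigma>. barrier \<eta> \<epsilon> \<delta> E z x \<ge> barrier \<eta> \<epsilon> \<delta> E z x0 + a \<bullet> (x - x0)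
        + (\<epsilon> / (2 * d0) + \<delta> / (2 * d0\<^sup>2)) *
            ((norm (x - x0))\<^sup>2 - (1 + 16 * K * d0) * (\<Sum>b\<in>B. (b \<bullet> (x - x0))\<^sup>2))
        - (\<epsilon> / (2 * d0 ^ 3) + \<delta> / d0 ^ 4) * (y \<bullet> (x - x0))\<^sup>2 - (C + 2) * (norm (x - x0))\<^sup>2)"
    using barrier_quadratic_lower_bound[OF E \<Omega> z \<eta> \<epsilon>] by (elim exE conjE) (rule that, assumption+)
  \<comment> \<open>\<open>H\<close> collects the terms that stay bounded as \<open>d0\<close> and \<open>\<delta>\<close> tend to zero\<close>
  define H where "H = 8 * K * k * \<epsilon> + (C + 2) * (k + 2)"
  have H: "H > 0" unfolding H_def using K C \<epsilon> by (intro add_nonneg_pos) auto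
  define \<rho> where "\<rho> = min \<rho>0 (\<epsilon> / (4 * H))"
  have \<rho>: "\<rho> > 0" "\<rho> \<le> \<rho>0" "\<rho> \<le> \<epsilon> / (4 * H)" using \<rho>0 H \<epsilon> by (auto simp: \<rho>_def)
  define \<delta>1 where "\<delta>1 = \<epsilon> / (32 * K * k + 1)"
  have Kk: "32 * K * k + 1 > 0" using K by (simp add: add_nonneg_pos)
  have \<delta>1: "\<delta>1 > 0" using \<epsilon> Kk by (simp add: \<delta>1_def)
  have "\<exists>x\<in>ball x0 \<sigma> \<inter> (\<Omega> - E). u x - barrier \<eta> \<epsilon> \<delta> E z x < u x0 - barrier \<eta> \<epsilon> \<delta> E z x0"
    if \<delta>: "\<delta> > 0" "\<delta> \<le> \<delta>1" and x0: "x0 \<in> ball z \<rho> - E" and \<sigma>: "\<sigma> > 0" for \<delta> x0 \<sigma>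
  proof (rule ccontr)
    assume "\<not> ?thesis"
    then have touch: "u x - barrier \<eta> \<epsilon> \<delta> E z x \<ge> u x0 - barrier \<eta> \<epsilon> \<delta> E z x0"
      if "x \<in> ball x0 \<sigma>" "x \<in> \<Omega> - E" for x using that by force
    have x00: "x0 \<in> ball z \<rho>0 - E" using x0 \<rho>(2) by auto
    then have x0\<Omega>: "x0 \<in> \<Omega> - E" using sub by auto
    obtain d0 y B a \<sigma>' where d0: "infdist x0 E = d0" "0 < d0" "norm y = d0"
      and B: "finite B" "card B \<le> k" "\<forall>b\<in>B. norm b = 1" and \<sigma>': "\<sigma>' > 0"
      and bar: "\<forall>x\<in>ball x0 \<sigma>'. barrier \<eta> \<epsilon> \<delta> E z x \<ge> barrier \<eta> \<epsilon> \<delta> E z x0 + a \<bullet> (x - x0)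
        + (\<epsilon> / (2 * d0) + \<delta> / (2 * d0\<^sup>2)) *
            ((norm (x - x0))\<^sup>2 - (1 + 16 * K * d0) * (\<Sum>b\<in>B. (b \<bullet> (x - x0))\<^sup>2))
        - (\<epsilon> / (2 * d0 ^ 3) + \<delta> / d0 ^ 4) * (y \<bullet> (x - x0))\<^sup>2 - (C + 2) * (norm (x - x0))\<^sup>2"
      using low[rule_format, OF \<delta>(1) x00] by (elim exE conjE) (rule that, assumption+)
    define p where "p = \<epsilon> / (2 * d0) + \<delta> / (2 * d0\<^sup>2)"
    define \<alpha> where "\<alpha> = p - (C + 2)"
    define \<beta> where "\<beta> = p * (1 + 16 * K * d0)"
    define \<gamma> where "\<gamma> = \<epsilon> / (2 * d0 ^ 3) + \<delta> / d0 ^ 4"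
    have p0: "p \<ge> 0" and \<beta>0: "\<beta> \<ge> 0" and \<gamma>0: "\<gamma> \<ge> 0"
      using d0(2) \<delta>(1) \<epsilon> K by (auto simp: p_def \<beta>_def \<gamma>_def)
    define f where "f w = \<alpha> *\<^sub>R w - \<beta> *\<^sub>R (\<Sum>b\<in>B. (b \<bullet> w) *\<^sub>R b) - (\<gamma> * (y \<bullet> w)) *\<^sub>R y" for w
    have linf: "linear f"
      unfolding f_def by (rule linearI)
        (simp_all add: inner_add_right sum.distrib scaleR_add_left scaleR_add_right algebra_simps scaleR_sum_right)
    have saf: "f v \<bullet> w = v \<bullet> f w" for v w
      unfolding f_def
      by (simp add: inner_diff_left inner_diff_right inner_sum_left inner_sum_right inner_commute mult_ac)
    have quad: "w \<bullet> f w = \<alpha> * (norm w)\<^sup>2 - \<beta> * (\<Sum>b\<in>B. (b \<bullet> w)\<^sup>2) - \<gamma> * (y \<bullet> w)\<^sup>2" for w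
      unfolding f_def
      by (simp add: inner_diff_right inner_sum_right dot_square_norm power2_eq_square inner_commute)
    let ?\<phi> = "\<lambda>x. u x0 + a \<bullet> (x - x0) + (x - x0) \<bullet> f (x - x0)"
    have "(\<Sum>i=1..k+2. eigval i (hessian ?\<phi> x0)) \<le> 0"
    proof -
      have "?\<phi> x \<le> u x" if "x \<in> ball x0 (min \<sigma> \<sigma>') \<inter> (\<Omega> - E)" for x
      proof -
        have "u x - barrier \<eta> \<epsilon> \<delta> E z x \<ge> u x0 - barrier \<eta> \<epsilon> \<delta> E z x0" using that by (intro touch) auto
        moreover have "barrier \<eta> \<epsilon> \<delta> E z x \<ge> barrier \<eta> \<epsilon> \<delta> E z x0 + a \<bullet> (x - x0)
          + p * ((norm (x - x0))\<^sup>2 - (1 + 16 * K * d0) * (\<Sum>b\<in>B. (b \<bullet> (x - x0))\<^sup>2))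
          - \<gamma> * (y \<bullet> (x - x0))\<^sup>2 - (C + 2) * (norm (x - x0))\<^sup>2"
          using that bar unfolding p_def \<gamma>_def by auto
        ultimately show ?thesis unfolding quad \<alpha>_def \<beta>_def by (simp add: algebra_simps)
      qed
      moreover have "Ck_on 2 ?\<phi> (ball x0 (min \<sigma> \<sigma>'))" by (rule quadratic_Ck2_hessian(1)[OF linf saf])
      moreover have "?\<phi> x0 = u x0" using linf by (simp add: linear_0)
      moreover have "x0 \<in> ball x0 (min \<sigma> \<sigma>')" using \<sigma> \<sigma>' by simp
      ultimately show ?thesis
        using visc[unfolded visc_eigval_sum_nonpos_def, rule_format, of x0 "ball x0 (min \<sigma> \<sigma>')" ?\<phi>] x0\<Omega>
        by (simp del: min_less_iff_conj)
    qed
    moreover have "hessian ?\<phi> x0 = matrix (\<lambda>v. 2 *\<^sub>R f v)" by (rule quadratic_Ck2_hessian(2)[OF linf saf])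
    ultimately have le0: "(\<Sum>i=1..k+2. eigval i (matrix (\<lambda>v. 2 *\<^sub>R f v))) \<le> 0" by simp
    have sym: "transpose (matrix (\<lambda>v. 2 *\<^sub>R f v)) = matrix (\<lambda>v. 2 *\<^sub>R f v)"
    proof -
      have "f (axis i 1) $ j = f (axis j 1) $ i" for i j
        using saf[of "axis i 1" "axis j 1"] by (simp add: inner_axis inner_axis')
      then show ?thesis by (simp add: vec_eq_iff transpose_def matrix_def)
    qed
    obtain W where W: "finite W" "card W = k + 2" "\<And>v. v \<in> W \<Longrightarrow> norm v = 1" "pairwise orthogonal W"
      and tr: "(\<Sum>i=1..k+2. eigval i (matrix (\<lambda>v. 2 *\<^sub>R f v))) = (\<Sum>v\<in>W. v \<bullet> (matrix (\<lambda>v. 2 *\<^sub>R f v) *v v))"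
      by (rule eigval_sum_eq_orthonormal_trace[OF sym k]) blast
    have "matrix (\<lambda>v. 2 *\<^sub>R f v) *v v = 2 *\<^sub>R f v" for v
      using matrix_works[of "\<lambda>v. 2 *\<^sub>R f v" v] linear_compose_scale_right[OF linf, of 2] by simp
    then have "(\<Sum>v\<in>W. v \<bullet> f v) \<le> 0"
      using le0 unfolding tr by (simp add: sum_distrib_left[symmetric])
    moreover have "(\<Sum>v\<in>W. v \<bullet> f v) \<ge> \<alpha> * card W - \<beta> * card B - \<gamma> * (norm y)\<^sup>2"
      unfolding f_def
      by (rule trace_rank_perturbation) (use W B \<beta>0 \<gamma>0 in \<open>auto intro: Bessel_finite\<close>)
    moreover have "\<beta> * card B \<le> \<beta> * k" using B(2) \<beta>0 by (intro mult_left_mono) auto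
    ultimately have "\<alpha> * (k + 2) - \<beta> * k - \<gamma> * d0\<^sup>2 \<le> 0" using W(2) d0(3) by simp
    moreover have "\<alpha> * (k + 2) - \<beta> * k - \<gamma> * d0\<^sup>2 = \<epsilon> / (2 * d0) - 8 * K * k * \<delta> / d0 - H"
    proof -
      have "\<gamma> * d0\<^sup>2 = \<epsilon> / (2 * d0) + \<delta> / d0\<^sup>2"
        unfolding \<gamma>_def using d0(2) by (simp add: field_simps power2_eq_square power3_eq_cube power4_eq_xxxx)
      moreover have "2 * p = \<epsilon> / d0 + \<delta> / d0\<^sup>2"
        unfolding p_def using d0(2) by (simp add: field_simps)
      moreover have "16 * K * k * (p * d0) = 8 * K * k * \<epsilon> + 8 * K * k * \<delta> / d0"
        unfolding p_def using d0(2) by (simp add: field_simps power2_eq_square)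
      moreover have "\<alpha> * (k + 2) - \<beta> * k = 2 * p - 16 * K * k * (p * d0) - (C + 2) * (k + 2)"
        unfolding \<alpha>_def \<beta>_def by (simp add: algebra_simps)
      moreover have "\<epsilon> / d0 = \<epsilon> / (2 * d0) + \<epsilon> / (2 * d0)" by simp
      ultimately show ?thesis unfolding H_def by linarith
    qed
    moreover have "8 * K * k * \<delta> / d0 \<le> \<epsilon> / (4 * d0)"
    proof -
      have "\<delta> * (32 * K * k + 1) \<le> \<epsilon>" using \<delta>(2) Kk by (simp add: \<delta>1_def pos_le_divide_eq)
      then have "8 * K * k * \<delta> \<le> \<epsilon> / 4" using \<delta>(1) by (simp add: algebra_simps)
      then have "8 * K * k * \<delta> / d0 \<le> \<epsilon> / 4 / d0" using d0(2) by (intro divide_right_mono) auto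
      then show ?thesis by simp
    qed
    moreover have "\<epsilon> / (4 * d0) > H"
    proof -
      have "d0 < \<rho>" using infdist_le[OF z, of x0] x0 d0(1) by (simp add: dist_commute)
      then have "d0 < \<epsilon> / (4 * H)" using \<rho>(3) by simp
      then show ?thesis using d0(2) H by (simp add: field_simps)
    qed
    moreover have "\<epsilon> / (2 * d0) = \<epsilon> / (4 * d0) + \<epsilon> / (4 * d0)" by simp
    ultimately show False by linarith
  qed
  moreover have "ball z \<rho> \<subseteq> \<Omega>" using sub \<rho>(2) by auto
  ultimately show ?thesis using \<rho>(1) \<delta>1 by (intro exI[of _ \<rho>] conjI exI[of _ \<delta>1]) auto
qed

section \<open>Lower semicontinuity\<close>

lemma lsc_on_liminf_extension:
  fixes \<Omega> E :: "(real ^ 'n) set"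
  assumes \<Omega>: "open \<Omega>" and E: "closed E" and u: "lsc_on (\<Omega> - E) u"
  shows "lsc_on \<Omega> (liminf_extension \<Omega> E u)"
  unfolding lsc_on_def
proof (intro ballI allI impI)
  fix x c assume x: "x \<in> \<Omega>" and c: "c < liminf_extension \<Omega> E u x"
  have op: "open (\<Omega> - E)" using \<Omega> E by (rule open_Diff)
  show "eventually (\<lambda>y. c < liminf_extension \<Omega> E u y) (at x within \<Omega>)"
  proof (cases "x \<in> E")
    case False
    obtain c' where c': "c < ereal c'" "c' < u x"
      using c False by (auto simp: liminf_extension_def dest: ereal_dense2)
    have xx: "x \<in> \<Omega> - E" using x False by simp
    then have "eventually (\<lambda>y. c' < u y) (at x)"
      using u c'(2) op unfolding lsc_on_def by (metis at_within_open)
    moreover have "eventually (\<lambda>y. y \<in> \<Omega> - E) (at x)" using op xx by (rule eventually_at_in_open')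
    ultimately have "eventually (\<lambda>y. c < liminf_extension \<Omega> E u y) (at x)"
    proof eventually_elim
      case (elim y)
      then show ?case using c'(1) less_trans[of c "ereal c'" "ereal (u y)"] by (simp add: liminf_extension_def)
    qed
    then show ?thesis using at_within_open[OF x \<Omega>] by simp
  next
    case True
    then have "c < Liminf (at x within (\<Omega> - E)) (\<lambda>y. ereal (u y))" using c by (simp add: liminf_extension_def)
    then obtain c' where c': "c < c'" "c' < Liminf (at x within (\<Omega> - E)) (\<lambda>y. ereal (u y))"
      using dense by blast
    have "eventually (\<lambda>y. c' < ereal (u y)) (at x within (\<Omega> - E))"
      using c'(2) by (rule less_LiminfD)
    then obtain T where T: "open T" "x \<in> T" "\<And>y. y \<in> T \<Longrightarrow> y \<noteq> x \<Longrightarrow> y \<in> \<Omega> - E \<Longrightarrow> c' < ereal (u y)"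
      by (auto simp: eventually_at_topological)
    \<comment> \<open>the bound \<open>c'\<close> on \<open>T - E\<close> passes to the lower limits at other points of \<open>E\<close> in \<open>T\<close>\<close>
    have "c < liminf_extension \<Omega> E u y" if y: "y \<in> T" "y \<in> \<Omega>" for y
    proof (cases "y \<in> E")
      case False
      then have "c' < ereal (u y)" using T(3)[of y] y True by auto
      then show ?thesis using False c'(1) by (auto simp: liminf_extension_def)
    next
      case yE: True
      have "eventually (\<lambda>w. c' < ereal (u w)) (at y within (\<Omega> - E))"
        using T y True by (auto simp: eventually_at_topological)
      then have "c' \<le> Liminf (at y within (\<Omega> - E)) (\<lambda>w. ereal (u w))"
        by (intro Liminf_bounded) (auto elim: eventually_mono)
      then show ?thesis using yE c'(1) by (simp add: liminf_extension_def)
    qed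
    then show ?thesis using T(1,2) by (auto simp: eventually_at_topological)
  qed
qed

lemma liminf_extension_bounded_below:
  fixes \<Omega> E :: "(real ^ 'n) set"
  assumes "bdd_below (u ` (\<Omega> - E))"
  obtains m :: real where "\<And>x. x \<in> \<Omega> \<Longrightarrow> ereal m \<le> liminf_extension \<Omega> E u x"
proof -
  obtain m where m: "\<And>x. x \<in> \<Omega> - E \<Longrightarrow> m \<le> u x" using assms by (auto simp: bdd_below_def)
  have "ereal m \<le> liminf_extension \<Omega> E u x" if "x \<in> \<Omega>" for x
  proof (cases "x \<in> E")
    case True
    have "eventually (\<lambda>y. ereal m \<le> ereal (u y)) (at x within (\<Omega> - E))"
      using m by (auto simp: eventually_at_filter)
    then show ?thesis using True by (auto simp: liminf_extension_def intro: Liminf_bounded)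
  qed (use m that in \<open>auto simp: liminf_extension_def\<close>)
  then show ?thesis by (rule that)
qed

text \<open>
  If there were no minimum, each \<open>x\<close> in \<open>K\<close> would have some \<open>q x\<close> in \<open>K\<close> with a smaller value.
  By lower semicontinuity the points of \<open>K\<close> with \<open>W\<close> above \<open>W (q x)\<close> form a relative neighbourhood of \<open>x\<close>; finitely many cover \<open>K\<close>, and the point with the least of the
  values \<open>W (q x)\<close> lies in none of them.
\<close>

lemma lsc_attains_min:
  fixes W :: "'a::topological_space \<Rightarrow> real"
  assumes "compact K" "K \<noteq> {}"
    and lsc: "\<And>x c. x \<in> K \<Longrightarrow> c < W x \<Longrightarrow> eventually (\<lambda>y. c < W y) (at x within K)"
  shows "\<exists>x\<in>K. \<forall>y\<in>K. W x \<le> W y"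
proof (rule ccontr)
  assume "\<not> ?thesis"
  then have "\<forall>x\<in>K. \<exists>y\<in>K. W y < W x" by force
  then obtain q where q: "\<And>x. x \<in> K \<Longrightarrow> q x \<in> K" "\<And>x. x \<in> K \<Longrightarrow> W (q x) < W x" by metis
  have "\<forall>x\<in>K. \<exists>T. open T \<and> x \<in> T \<and> (\<forall>y\<in>T\<inter>K. W (q x) < W y)"
  proof
    fix x assume x: "x \<in> K"
    from lsc[OF x q(2)[OF x]] obtain T where "open T" "x \<in> T" "\<forall>y\<in>T. y \<noteq> x \<longrightarrow> y \<in> K \<longrightarrow> W (q x) < W y"
      by (auto simp: eventually_at_topological)
    then show "\<exists>T. open T \<and> x \<in> T \<and> (\<forall>y\<in>T\<inter>K. W (q x) < W y)"
      using q(2)[OF x] by (intro exI[of _ T]) auto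
  qed
  then obtain T where T: "\<And>x. x \<in> K \<Longrightarrow> open (T x)" "\<And>x. x \<in> K \<Longrightarrow> x \<in> T x"
    "\<And>x y. x \<in> K \<Longrightarrow> y \<in> T x \<Longrightarrow> y \<in> K \<Longrightarrow> W (q x) < W y" by (metis IntI)
  obtain F where F: "F \<subseteq> K" "finite F" "K \<subseteq> (\<Union>x\<in>F. T x)"
    using compactE_image[OF assms(1), of K T] T by blast
  then have "F \<noteq> {}" using assms(2) by auto
  define p where "p = arg_min_on (\<lambda>x. W (q x)) F"
  have p: "p \<in> F" "\<And>x. x \<in> F \<Longrightarrow> W (q p) \<le> W (q x)"
    unfolding p_def using arg_min_if_finite(1)[OF F(2) \<open>F \<noteq> {}\<close>, of "\<lambda>x. W (q x)"] arg_min_least[OF F(2) \<open>F \<noteq> {}\<close>, of _ "\<lambda>x. W (q x)"] by auto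
  then have "q p \<in> K" using F q by blast
  then obtain p' where "p' \<in> F" "q p \<in> T p'" using F(3) by blast
  then have "W (q p') < W (q p)" using T(3) F(1) \<open>q p \<in> K\<close> by blast
  with p(2)[OF \<open>p' \<in> F\<close>] show False by simp
qed

theorem theorem1p4:
  fixes \<Omega> E :: "(real ^ 'n) set"
    and F :: "(real ^ 'n) \<times> real \<times> (real ^ 'n) \<times> (real ^ 'n ^ 'n) \<Rightarrow> real"
    and f u :: "real ^ 'n \<Rightarrow> real"
    and k :: nat
  assumes "CARD('n) \<ge> 2"
    and "bounded \<Omega>" and "connected \<Omega>" and "open \<Omega>"
    and "continuous_on (\<Omega> \<times> UNIV \<times> UNIV \<times> sym_matrices) F"
    and "\<And>x s p M N. x \<in> \<Omega> \<Longrightarrow> M \<in> sym_matrices \<Longrightarrow> N \<in> pos_def_matrices \<Longrightarrow>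
           F (x, s, p, M + N) \<ge> F (x, s, p, M)"
    and "k \<le> CARD('n) - 2"
    and "E \<subseteq> \<Omega>" and "smooth_closed_submanifold k E"
    and "usc_on \<Omega> f"
    and "lsc_on (\<Omega> - E) u"
    and "bdd_below (u ` (\<Omega> - E))"
    and "visc_eigval_sum_nonpos (k + 2) (\<Omega> - E) u"
  shows "lsc_on \<Omega> (liminf_extension \<Omega> E u) \<and>
         lowerconical_on \<Omega> E (liminf_extension \<Omega> E u)"
proof -
  let ?v = "liminf_extension \<Omega> E u"
  have clE: "closed E" using assms(9) by (auto simp: smooth_closed_submanifold_def compact_imp_closed)
  have lsc: "lsc_on \<Omega> ?v" by (rule lsc_on_liminf_extension[OF assms(4) clE assms(11)])
  obtain m :: real where m: "\<And>x. x \<in> \<Omega> \<Longrightarrow> ereal m \<le> ?v x"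
    using liminf_extension_bounded_below[OF assms(12)] by blast
  have "ereal m \<le> (INF x\<in>\<Omega>. ?v x)" using m by (rule INF_greatest)
  then have inf: "(INF x\<in>\<Omega>. ?v x) > -\<infinity>" by (rule less_le_trans[rotated]) simp
  have "(INF x\<in>\<Omega>. (?v x + ereal (\<eta> x)) - (?v z + ereal (\<eta> z)) - ereal (\<epsilon> * infdist x E)) < 0"
    if z: "z \<in> E" and \<epsilon>: "\<epsilon> > 0" and \<eta>: "Cinf_on \<eta> \<Omega>" and fin: "?v z \<noteq> \<infinity>" for \<eta> z \<epsilon>
  proof (rule ccontr)
    assume "\<not> ?thesis"
    then have nonneg: "0 \<le> (?v x + ereal (\<eta> x)) - (?v z + ereal (\<eta> z)) - ereal (\<epsilon> * infdist x E)"
      if "x \<in> \<Omega>" for x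
      using that by (meson INF_lower not_less order_trans)
    have z\<Omega>: "z \<in> \<Omega>" using z assms(8) by blast
    have "?v z \<noteq> -\<infinity>" using m[OF z\<Omega>] by auto
    then obtain c where c: "?v z = ereal c" using fin by (cases "?v z") auto
    have cone: "u x + \<eta> x \<ge> c + \<eta> z + \<epsilon> * infdist x E" if "x \<in> \<Omega> - E" for x
      using nonneg[of x] that by (simp add: c) (simp add: liminf_extension_def)
    have \<eta>2: "Ck_on 2 \<eta> \<Omega>" using \<eta> by (simp add: Cinf_on_def)
    have \<eta>cont: "isCont \<eta> x" if "x \<in> \<Omega>" for x
      using \<eta>2 that by (auto simp: numeral_2_eq_2 intro: differentiable_imp_continuous_within)
    have dpos: "infdist x E > 0" if "x \<notin> E" for x
      using that clE z by (metis empty_iff in_closed_iff_infdist_zero infdist_nonneg less_eq_real_def)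
    obtain \<rho> \<delta>1 where \<rho>: "\<rho> > 0" "ball z \<rho> \<subseteq> \<Omega>" and \<delta>1: "\<delta>1 > 0"
      and touch: "\<And>\<delta> x0 \<sigma>. \<delta> > 0 \<Longrightarrow> \<delta> \<le> \<delta>1 \<Longrightarrow> x0 \<in> ball z \<rho> - E \<Longrightarrow> \<sigma> > 0 \<Longrightarrow>
        \<exists>x\<in>ball x0 \<sigma> \<inter> (\<Omega> - E). u x - barrier \<eta> \<epsilon> \<delta> E z x < u x0 - barrier \<eta> \<epsilon> \<delta> E z x0"
    proof -
      have "k + 2 \<le> CARD('n)" using assms(1,7) by simp
      from barrier_touches_nowhere[OF assms(9,4,8) z \<eta>2 \<epsilon> this assms(13)]
      show ?thesis using that by blast
    qed
    \<comment> \<open>\<open>\<kappa>\<close> is half of what \<open>\<bar>x - z\<bar>\<^sup>2\<close> gains on the sphere of radius \<open>r\<close>; the four quantities that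
      raise \<open>w\<close> at the comparison point \<open>y\<close> are each given a quarter of \<open>\<kappa>\<close>\<close>
    define r where "r = min \<rho> 1 / 2"
    have r: "r > 0" "r < 1" "cball z r \<subseteq> ball z \<rho>" using \<rho>(1) by (auto simp: r_def)
    define \<kappa> where "\<kappa> = r\<^sup>2 / 2"
    have \<kappa>: "\<kappa> > 0" "r\<^sup>2 = 2 * \<kappa>" using r by (auto simp: \<kappa>_def)
    obtain y where y: "y \<in> \<Omega> - E" "norm (y - z) < r" "u y < c + \<kappa> / 4" "\<eta> y < \<eta> z + \<kappa> / 4" "(norm (y - z))\<^sup>2 < \<kappa> / 4"
    proof -
      have "\<not> eventually (\<lambda>y. \<not> u y < c + \<kappa> / 4) (at z within (\<Omega> - E))"
      proof
        assume "eventually (\<lambda>y. \<not> u y < c + \<kappa> / 4) (at z within (\<Omega> - E))"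
        then have "ereal (c + \<kappa> / 4) \<le> Liminf (at z within (\<Omega> - E)) (\<lambda>y. ereal (u y))"
          by (intro Liminf_bounded) (auto elim: eventually_mono)
        then show False using c z \<kappa>(1) by (simp add: liminf_extension_def)
      qed
      then have "frequently (\<lambda>y. u y < c + \<kappa> / 4) (at z within (\<Omega> - E))" by (simp add: frequently_def)
      moreover have "eventually (\<lambda>y. y \<in> \<Omega> - E \<and> norm (y - z) < r \<and> \<eta> y < \<eta> z + \<kappa> / 4 \<and> (norm (y - z))\<^sup>2 < \<kappa> / 4)
         (at z within (\<Omega> - E))"
      proof (intro eventually_conj)
        show "eventually (\<lambda>y. y \<in> \<Omega> - E) (at z within (\<Omega> - E))" by (auto simp: eventually_at_filter)
        have n: "((\<lambda>y. norm (y - z)) \<longlongrightarrow> 0) (at z within (\<Omega> - E))"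
          by (auto intro!: tendsto_eq_intros)
        show "eventually (\<lambda>y. norm (y - z) < r) (at z within (\<Omega> - E))"
          using order_tendstoD(2)[OF n r(1)] .
        show "eventually (\<lambda>y. (norm (y - z))\<^sup>2 < \<kappa> / 4) (at z within (\<Omega> - E))"
          using order_tendstoD(2)[OF tendsto_power[OF n, of 2], of "\<kappa> / 4"] \<kappa>(1) by simp
        have "(\<eta> \<longlongrightarrow> \<eta> z) (at z within (\<Omega> - E))"
          using \<eta>cont[OF z\<Omega>] unfolding isCont_def by (rule tendsto_within_subset) simp
        then show "eventually (\<lambda>y. \<eta> y < \<eta> z + \<kappa> / 4) (at z within (\<Omega> - E))"
          using \<kappa>(1) by (intro order_tendstoD(2)) auto
      qed
      ultimately show ?thesis
        using frequently_ex[OF frequently_eventually_frequently] that by blast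
    qed
    \<comment> \<open>\<open>y\<close> is chosen before \<open>\<delta>\<close>, so that the logarithmic term is small at \<open>y\<close>\<close>
    define N where "N = 1 + \<bar>ln (infdist y E)\<bar>"
    have N: "N > 0" unfolding N_def by (rule add_pos_nonneg) auto
    define \<delta> where "\<delta> = min \<delta>1 (\<kappa> / 4 / N)"
    have \<delta>: "\<delta> > 0" "\<delta> \<le> \<delta>1" using \<delta>1 \<kappa>(1) N by (auto simp: \<delta>_def)
    have \<delta>ln: "- \<delta> * ln (infdist y E) \<le> \<kappa> / 4"
    proof -
      have "- \<delta> * ln (infdist y E) \<le> \<delta> * N"
        using \<delta>(1) mult_left_mono[of "- ln (infdist y E)" N \<delta>] by (simp add: N_def)
      also have "\<dots> \<le> \<kappa> / 4 / N * N"
        using N by (intro mult_right_mono) (auto simp: \<delta>_def)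
      also have "\<dots> = \<kappa> / 4" using N by simp
      finally show ?thesis .
    qed
    define w where "w x = u x - barrier \<eta> \<epsilon> \<delta> E z x" for x
    define T where "T = c + \<eta> z + \<kappa>"
    have wlow: "w x \<ge> c + \<eta> z - \<delta> * ln (infdist x E) + (norm (x - z))\<^sup>2" if "x \<in> \<Omega> - E" for x
      using cone[OF that] by (simp add: w_def barrier_def)
    have wy: "w y < T"
    proof -
      have "\<epsilon> * infdist y E \<ge> 0" using \<epsilon> infdist_nonneg[of y E] by simp
      then show ?thesis using y(3,4,5) \<delta>ln unfolding w_def barrier_def T_def by simp
    qed
    \<comment> \<open>at distance \<open>\<theta>\<close> from \<open>E\<close> the logarithmic term alone contributes \<open>\<kappa>\<close>\<close>
    define \<theta> where "\<theta> = exp (- \<kappa> / \<delta>)"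
    have wnear: "w x \<ge> T" if "x \<in> \<Omega> - E" "infdist x E \<le> \<theta>" for x
    proof -
      have "ln (infdist x E) \<le> - \<kappa> / \<delta>"
        using that dpos[of x] ln_le_cancel_iff[of "infdist x E" \<theta>] by (simp add: \<theta>_def)
      then have "\<delta> * ln (infdist x E) \<le> - \<kappa>" using \<delta>(1) by (simp add: field_simps)
      then show ?thesis using wlow[OF that(1)] zero_le_power2[of "norm (x - z)"] unfolding T_def by linarith
    qed
    have wfar: "w x > T" if "x \<in> \<Omega> - E" "norm (x - z) = r" for x
    proof -
      have "infdist x E \<le> 1" using infdist_le[OF z, of x] that(2) r(2) by (simp add: dist_norm)
      then have "\<delta> * ln (infdist x E) \<le> 0" using \<delta>(1) dpos[of x] that(1) by (simp add: mult_le_0_iff)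
      then show ?thesis using wlow[OF that(1)] that(2) \<kappa> unfolding T_def by simp
    qed
    define A where "A = cball z r \<inter> {x. \<theta> \<le> infdist x E}"
    have A\<Omega>: "A \<subseteq> \<Omega> - E" 
      using r(3) \<rho>(2) by (auto simp: A_def \<theta>_def not_le)
    have "compact A"
      unfolding A_def by (intro compact_Int_closed compact_cball closed_Collect_le continuous_intros)
    moreover have yA: "y \<in> A"
      using y(1,2) wnear[of y] wy by (force simp: A_def dist_norm norm_minus_commute)
    moreover have "eventually (\<lambda>x'. c' < w x') (at x within A)" if x: "x \<in> A" and c': "c' < w x" for x c'
    proof -
      define \<mu> where "\<mu> = (w x - c') / 2"
      have \<mu>: "\<mu> > 0" using c' by (simp add: \<mu>_def)
      have x\<Omega>: "x \<in> \<Omega> - E" using x A\<Omega> by blast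
      have "eventually (\<lambda>x'. u x - \<mu> < u x') (at x within (\<Omega> - E))"
        using assms(11) x\<Omega> \<mu> unfolding lsc_on_def by simp
      then have 1: "eventually (\<lambda>x'. u x - \<mu> < u x') (at x within A)"
        using A\<Omega> by (meson at_le filter_leD)
      have "isCont (barrier \<eta> \<epsilon> \<delta> E z) x"
        unfolding barrier_def[abs_def] using dpos[of x] \<eta>cont[of x] x\<Omega>
        by (intro continuous_intros) auto
      then have "((barrier \<eta> \<epsilon> \<delta> E z) \<longlongrightarrow> barrier \<eta> \<epsilon> \<delta> E z x) (at x within A)"
        unfolding isCont_def by (rule tendsto_within_subset) simp
      then have 2: "eventually (\<lambda>x'. barrier \<eta> \<epsilon> \<delta> E z x' < barrier \<eta> \<epsilon> \<delta> E z x + \<mu>) (at x within A)"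
        using \<mu> by (intro order_tendstoD(2)) auto
      from 1 2 show ?thesis
        by eventually_elim (simp add: w_def \<mu>_def field_simps)
    qed
    ultimately obtain x0 where x0: "x0 \<in> A" "\<And>x. x \<in> A \<Longrightarrow> w x0 \<le> w x"
      using lsc_attains_min[of A w] by blast
    have x0\<Omega>: "x0 \<in> \<Omega> - E" using x0(1) A\<Omega> by blast
    have "w x0 < T" using x0(2)[OF yA] wy by simp
    then have "norm (x0 - z) \<noteq> r" "\<theta> < infdist x0 E"
      using wfar[OF x0\<Omega>] wnear[OF x0\<Omega>] by force+
    then have x0in: "x0 \<in> ball z r \<inter> {x. \<theta> < infdist x E}"
      using x0(1) by (auto simp: A_def dist_norm norm_minus_commute)
    have "open (ball z r \<inter> {x. \<theta> < infdist x E})"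
      by (intro open_Int open_ball open_Collect_less continuous_intros)
    then obtain \<sigma> where \<sigma>: "\<sigma> > 0" "ball x0 \<sigma> \<subseteq> ball z r \<inter> {x. \<theta> < infdist x E}"
      using x0in open_contains_ball by blast
    have "x0 \<in> ball z \<rho> - E" using x0\<Omega> x0(1) r(3) unfolding A_def by blast
    from touch[OF \<delta> this \<sigma>(1)] obtain x where x: "x \<in> ball x0 \<sigma>" "w x < w x0" by (auto simp: w_def)
    have "x \<in> A" using x(1) \<sigma>(2) by (auto simp: A_def)
    from x0(2)[OF this] x(2) show False by simp
  qed
  then show ?thesis using lsc inf unfolding lowerconical_on_def by blast
qed

end
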